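(* Let $W\in Gr_n(\mathbb{C})$ be a point of the big cell of the Sato Grassmannian, and suppose that $W$ corresponds to the pseudo-differential operator $S\in G=I_n+gl_n(\mathbb{C}[[x]])[[\partial^{-1}]]\cdot\partial^{-1}$. Then $W^\bot$ corresponds to $(S^* )^{-1}\in G$.
   Context: Grassmannian. $Gr_n(\mathbb{C})$ is the set of $\mathbb{C}$-subspaces $W\subset\mathbb{C}((z))^{\oplus n}$ such that the natural map $\gamma_W:W\to\mathbb{C}((z))^{\oplus n}/\mathbb{C}[[z]]^{\oplus n}$ has finite-dimensional kernel and cokernel. The big cell is the set of $W$ for which $\gamma_W$ is an isomorphism. For $f,h\in\mathbb{C}((z))^{\oplus n}$ put $\langle f,h\rangle_n=\sum_{i=1}^n(\text{coefficient of }z^{-1}\text{ in }f_ih_i)$ and $W^\bot=\{f\in\mathbb{C}((z))^{\oplus n}\mid\langle f,w\rangle_n=0\ \forall w\in W\}$. Pseudo-differential operators. $\partial=d/dx$, $\mathcal{D}=\mathbb{C}[[x]][\partial]$, $\mathcal{E}=\mathcal{D}+\mathbb{C}[[x]][[\partial^{-1}]]$, with product determined by $\partial^m\cdot a(x)=\sum_{i\ge0}\binom{m}{i}a^{(i)}(x)\partial^{m-i}$ for $m\in\mathbb{Z}$. $\mathcal{E}/\mathcal{E}x$ is identified with $\mathbb{C}((\partial^{-1}))$ as a vector space: with $\rho:\mathcal{E}\to\mathbb{C}((\partial^{-1}))$ the projection (write an operator as $\sum_m\partial^m b_m(x)$ and set $x=0$), $\mathcal{E}$ acts on $\mathbb{C}((z))$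 through the identification $\mathbb{C}((z))\ni f(z)\leftrightarrow f(\partial^{-1})\partial^{-1}\in\mathbb{C}((\partial^{-1}))$, i.e. $P\cdot f(z)$ corresponds to $\rho(P\cdot f(\partial^{-1})\partial^{-1})$. Matrices $gl_n(\mathcal{E})$ act on $\mathbb{C}((z))^{\oplus n}$ accordingly. Adjoint. For $P=\sum_\ell a_\ell(x)\partial^\ell\in\mathcal{E}$, $P^*=\sum_\ell\partial^\ell\cdot a_\ell(-x)$; for a matrix $P=[P_{ij}]$, $P^*=[P_{ji}^*]$ (transpose and entrywise adjoint). Correspondence. $G$ is the group of monic pseudo-differential operators of order $0$ with $n\times n$ matrix coefficients. $S\in G$ and $W$ in the big cell correspond to each other (bijectively) when $W=S^{-1}\cdot\mathbb{C}[z^{-1}]^{\oplus n}\cdot z^{-1}$. *)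

theory Defs
  imports "HOL-Analysis.Analysis" "HOL-Computational_Algebra.Formal_Laurent_Series"
begin

section \<open>The ring of formal pseudo-differential operators over the power series\<close>

text \<open>An operator \<open>\<Sum>\<^sub>m a\<^sub>m(x) \<partial>\<^sup>m\<close> is given by its left coefficients \<open>a\<^sub>m\<close>, \<open>m \<in> \<int>\<close>, which
  vanish for large \<open>m\<close>.\<close>

definition bounded_order :: "(int \<Rightarrow> complex fps) \<Rightarrow> bool" where
  "bounded_order a \<longleftrightarrow> (\<exists>N. \<forall>m>N. a m = 0)"

typedef pdo = "{a. bounded_order a}"
  morphisms pdo_coeff Abs_pdo
  by (auto simp: bounded_order_def)

setup_lifting type_definition_pdo

lemma pdo_eqI: "(\<And>m. pdo_coeff P m = pdo_coeff Q m) \<Longrightarrow> P = Q"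
  by (simp add: pdo_coeff_inject[symmetric] fun_eq_iff)

lemma pdo_coeff_bounded: "\<exists>N. \<forall>m>N. pdo_coeff P m = 0"
  using pdo_coeff[of P] by (simp add: bounded_order_def)

instantiation pdo :: ab_group_add
begin

lift_definition zero_pdo :: pdo is "\<lambda>_. 0"
  by (auto simp: bounded_order_def)

lift_definition plus_pdo :: "pdo \<Rightarrow> pdo \<Rightarrow> pdo" is "\<lambda>a b m. a m + b m"
proof -
  fix a b :: "int \<Rightarrow> complex fps" assume "bounded_order a" "bounded_order b"
  then obtain M N where "\<forall>m>M. a m = 0" "\<forall>m>N. b m = 0" by (auto simp: bounded_order_def)
  then have "\<forall>m>max M N. a m + b m = 0" by simp
  then show "bounded_order (\<lambda>m. a m + b m)" unfolding bounded_order_def by blast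
qed

lift_definition uminus_pdo :: "pdo \<Rightarrow> pdo" is "\<lambda>a m. - a m"
  by (auto simp: bounded_order_def)

definition minus_pdo :: "pdo \<Rightarrow> pdo \<Rightarrow> pdo" where
  "minus_pdo P Q = P + (- Q)"

instance
  by standard (auto simp: minus_pdo_def zero_pdo.rep_eq plus_pdo.rep_eq uminus_pdo.rep_eq
    intro!: pdo_eqI)

end

lemma pdo_coeff_0 [simp]: "pdo_coeff 0 m = 0"
  and pdo_coeff_add [simp]: "pdo_coeff (P + Q) m = pdo_coeff P m + pdo_coeff Q m"
  and pdo_coeff_uminus [simp]: "pdo_coeff (- P) m = - pdo_coeff P m"
  by (simp_all add: zero_pdo.rep_eq plus_pdo.rep_eq uminus_pdo.rep_eq)

text \<open>Since \<open>a \<partial>\<^sup>l \<cdot> b \<partial>\<^sup>m = \<Sum>\<^sub>i (l choose i) a b\<^sup>(\<^sup>i\<^sup>) \<partial>\<^bsup>l+m-i\<^esup>\<close>, the coefficient of \<open>\<partial>\<^sup>k\<close> in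
  \<open>(\<Sum>\<^sub>l a\<^sub>l \<partial>\<^sup>l) \<cdot> (\<Sum>\<^sub>m b\<^sub>m \<partial>\<^sup>m)\<close> collects the terms with \<open>i = l + m - k\<close>. The index set of the sum is
  finite for operators.\<close>

definition pdo_prod_coeff ::
    "(int \<Rightarrow> complex fps) \<Rightarrow> (int \<Rightarrow> complex fps) \<Rightarrow> int \<Rightarrow> complex fps" where
  "pdo_prod_coeff a b k =
     (\<Sum>(l, m) | a l \<noteq> 0 \<and> b m \<noteq> 0 \<and> k \<le> l + m.
        fps_const (of_int l gchoose nat (l + m - k)) * a l * fps_nth_deriv (nat (l + m - k)) (b m))"

lemma pdo_prod_coeff_eq_0:
  assumes "\<And>l. l > p \<Longrightarrow> a l = 0" "\<And>m. m > q \<Longrightarrow> b m = 0" "k > p + q"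
  shows "pdo_prod_coeff a b k = 0"
proof -
  have "{(l, m). a l \<noteq> 0 \<and> b m \<noteq> 0 \<and> k \<le> l + m} = {}"
  proof safe
    fix l m assume "a l \<noteq> 0" "b m \<noteq> 0" "k \<le> l + m"
    with assms(1,2) have "l \<le> p" "m \<le> q" by (meson not_le)+
    with \<open>k \<le> l + m\<close> assms(3) show "(l, m) \<in> {}" by simp
  qed
  then show ?thesis unfolding pdo_prod_coeff_def by (simp only: sum.empty)
qed

instantiation pdo :: "{one, times}"
begin

lift_definition one_pdo :: pdo is "\<lambda>m. if m = 0 then 1 else 0"
  by (auto simp: bounded_order_def)

lift_definition times_pdo :: "pdo \<Rightarrow> pdo \<Rightarrow> pdo" is pdo_prod_coeff
proof -
  fix a b :: "int \<Rightarrow> complex fps" assume "bounded_order a" "bounded_order b"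
  then obtain p q where "\<forall>m>p. a m = 0" "\<forall>m>q. b m = 0" by (auto simp: bounded_order_def)
  then have "\<forall>k>p+q. pdo_prod_coeff a b k = 0"
    using pdo_prod_coeff_eq_0[of p a q b] by simp
  then show "bounded_order (pdo_prod_coeff a b)" unfolding bounded_order_def by blast
qed

instance ..

end

text \<open>Auxiliary for the ring laws: the binomial coefficient, set to zero for negative lower index.\<close>

definition pc :: "int \<Rightarrow> int \<Rightarrow> complex" where
  "pc l i = (if i < 0 then 0 else of_int l gchoose nat i)"

lemma pdo_prod_coeff_box:
  assumes p: "\<And>l. l > p \<Longrightarrow> a l = 0" and q: "\<And>m. m > q \<Longrightarrow> b m = 0"
    and "L \<le> k - q" "M \<le> k - p"
  shows "pdo_prod_coeff a b k =
    (\<Sum>l\<in>{L..p}. \<Sum>m\<in>{M..q}. fps_const (pc l (l + m - k)) * a l * fps_nth_deriv (nat (l + m - k)) (b m))"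
proof -
  have "pdo_prod_coeff a b k = (\<Sum>(l, m)\<in>{L..p} \<times> {M..q}.
     fps_const (pc l (l + m - k)) * a l * fps_nth_deriv (nat (l + m - k)) (b m))"
    unfolding pdo_prod_coeff_def
  proof (rule sum.mono_neutral_cong_left)
    show "{(l, m). a l \<noteq> 0 \<and> b m \<noteq> 0 \<and> k \<le> l + m} \<subseteq> {L..p} \<times> {M..q}"
    proof safe
      fix l m assume "a l \<noteq> 0" "b m \<noteq> 0" "k \<le> l + m"
      moreover from this p q have "l \<le> p" "m \<le> q" by (meson not_le)+
      ultimately show "l \<in> {L..p}" "m \<in> {M..q}" using assms(3,4) by auto
    qed
  qed (auto simp: pc_def split: if_splits)
  then show ?thesis by (simp add: sum.cartesian_product)
qed

lemma pdo_common_bound: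
  obtains h where "\<And>m. m > h \<Longrightarrow> pdo_coeff P m = 0" "\<And>m. m > h \<Longrightarrow> pdo_coeff Q m = 0"
    "\<And>m. m > h \<Longrightarrow> pdo_coeff R m = 0" "h \<ge> 0"
proof -
  obtain x y z where "\<forall>m>x. pdo_coeff P m = 0" "\<forall>m>y. pdo_coeff Q m = 0" "\<forall>m>z. pdo_coeff R m = 0"
    using pdo_coeff_bounded by meson
  then show ?thesis by (intro that[of "max (max x y) (max z 0)"]) auto
qed

lemma fps_nth_deriv_leibniz:
  "fps_nth_deriv n (f * g) =
    (\<Sum>i\<le>n. fps_const (of_nat (n choose i)) * fps_nth_deriv i f * fps_nth_deriv (n - i) g)"
  for f g :: "complex fps"
proof (induction n arbitrary: f g)
  case (Suc n)
  have "fps_nth_deriv (Suc n) (f * g) = fps_nth_deriv n (f * fps_deriv g) + fps_nth_deriv n (fps_deriv f * g)"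
    by simp
  also have "fps_nth_deriv n (f * fps_deriv g) =
      (\<Sum>i\<le>n. fps_const (of_nat (n choose i)) * fps_nth_deriv i f * fps_nth_deriv (Suc n - i) g)"
    unfolding Suc.IH by (intro sum.cong) (auto simp: Suc_diff_le)
  also have "\<dots> = (\<Sum>i\<le>Suc n. fps_const (of_nat (n choose i)) * fps_nth_deriv i f * fps_nth_deriv (Suc n - i) g)"
    by simp
  also have "\<dots> = f * fps_nth_deriv (Suc n) g +
     (\<Sum>i\<le>n. fps_const (of_nat (n choose Suc i)) * fps_nth_deriv (Suc i) f * fps_nth_deriv (n - i) g)"
    unfolding sum.atMost_Suc_shift by simp
  also have "fps_nth_deriv n (fps_deriv f * g) =
     (\<Sum>i\<le>n. fps_const (of_nat (n choose i)) * fps_nth_deriv (Suc i) f * fps_nth_deriv (n - i) g)"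
    unfolding Suc.IH by (intro sum.cong) auto
  also have "f * fps_nth_deriv (Suc n) g +
     (\<Sum>i\<le>n. fps_const (of_nat (n choose Suc i)) * fps_nth_deriv (Suc i) f * fps_nth_deriv (n - i) g) + \<dots>
    = (\<Sum>i\<le>Suc n. fps_const (of_nat (Suc n choose i)) * fps_nth_deriv i f * fps_nth_deriv (Suc n - i) g)"
    unfolding sum.atMost_Suc_shift
    by (simp add: sum.distrib[symmetric] algebra_simps flip: fps_const_add)
  finally show ?case .
qed simp

lemma fps_nth_deriv_add_index: "fps_nth_deriv i (fps_nth_deriv j f) = fps_nth_deriv (i + j) f"
  for f :: "complex fps"
  by (induction j arbitrary: f) simp_all

lemma sum_fps_const: "(\<Sum>i\<in>A. fps_const (f i)) = fps_const (\<Sum>i\<in>A. f i :: complex)"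
  by (induction A rule: infinite_finite_induct) simp_all

lemma triangle_swap:
  "(\<Sum>v\<le>n. \<Sum>i\<le>v. f v i) = (\<Sum>i\<le>n. \<Sum>v=i..n. f v i)" for n :: nat
proof -
  have "(\<Sum>v\<le>n. \<Sum>i\<le>v. f v i) = (\<Sum>v\<in>{..n}. \<Sum>i | i \<in> {..n} \<and> i \<le> v. f v i)"
    by (intro sum.cong) auto
  also have "\<dots> = (\<Sum>i\<in>{..n}. \<Sum>v | v \<in> {..n} \<and> i \<le> v. f v i)"
    by (rule sum.swap_restrict) auto
  also have "\<dots> = (\<Sum>i\<le>n. \<Sum>v=i..n. f v i)"
    by (intro sum.cong) auto
  finally show ?thesis .
qed

lemma pc_vandermonde:
  assumes "i \<le> n"
  shows "(\<Sum>v=i..n. (of_int l gchoose v) * of_nat (v choose i) * (of_int m gchoose (n - v))) =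
    (of_int l gchoose i) * ((of_int (l + m - int i) :: complex) gchoose (n - i))"
proof -
  have "(\<Sum>v=i..n. (of_int l gchoose v) * of_nat (v choose i) * (of_int m gchoose (n - v))) =
     (\<Sum>v=i..n. (of_int l gchoose i) * (((of_int l - of_nat i :: complex) gchoose (v - i)) * (of_int m gchoose (n - v))))"
    by (intro sum.cong refl)
      (simp add: binomial_gbinomial gbinomial_trinomial_revision mult.assoc)
  also have "\<dots> = (of_int l gchoose i) *
      (\<Sum>v=0..n-i. ((of_int l - of_nat i :: complex) gchoose v) * (of_int m gchoose ((n - i) - v)))"
    unfolding sum_distrib_left using assms
    by (intro sum.reindex_bij_witness[of _ "\<lambda>v. v + i" "\<lambda>v. v - i"]) auto
  also have "\<dots> = (of_int l gchoose i) * ((of_int (l + m - int i) :: complex) gchoose (n - i))"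
    unfolding gbinomial_Vandermonde by (simp add: algebra_simps)
  finally show ?thesis .
qed

lemma assoc_key_left:
  fixes a b c :: "complex fps"
  assumes "lo \<le> k - p" "l + m \<le> hi"
  shows "(\<Sum>s\<in>{lo..hi}. fps_const (pc s (s + p - k)) * (fps_const (pc l (l + m - s)) * a *
       fps_nth_deriv (nat (l + m - s)) b) * fps_nth_deriv (nat (s + p - k)) c) =
    (if l + m + p - k < 0 then 0 else
     \<Sum>i\<le>nat (l + m + p - k). fps_const ((of_int l gchoose i) * (of_int (l + m - int i) gchoose (nat (l + m + p - k) - i))) *
       a * fps_nth_deriv i b * fps_nth_deriv (nat (l + m + p - k) - i) c)"
proof -
  have "(\<Sum>s\<in>{lo..hi}. fps_const (pc s (s + p - k)) * (fps_const (pc l (l + m - s)) * a *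
       fps_nth_deriv (nat (l + m - s)) b) * fps_nth_deriv (nat (s + p - k)) c) =
    (\<Sum>s\<in>{k-p..l+m}. fps_const (pc s (s + p - k)) * (fps_const (pc l (l + m - s)) * a *
       fps_nth_deriv (nat (l + m - s)) b) * fps_nth_deriv (nat (s + p - k)) c)"
    using assms by (intro sum.mono_neutral_right) (auto simp: pc_def)
  also have "\<dots> = (if l + m + p - k < 0 then 0 else
     \<Sum>i\<le>nat (l + m + p - k). fps_const ((of_int l gchoose i) * (of_int (l + m - int i) gchoose (nat (l + m + p - k) - i))) *
       a * fps_nth_deriv i b * fps_nth_deriv (nat (l + m + p - k) - i) c)"
  proof (cases "l + m + p - k < 0")
    case False
    have "(\<Sum>s\<in>{k-p..l+m}. fps_const (pc s (s + p - k)) * (fps_const (pc l (l + m - s)) * a *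
       fps_nth_deriv (nat (l + m - s)) b) * fps_nth_deriv (nat (s + p - k)) c) =
      (\<Sum>i\<le>nat (l + m + p - k). fps_const ((of_int l gchoose i) * (of_int (l + m - int i) gchoose (nat (l + m + p - k) - i))) *
       a * fps_nth_deriv i b * fps_nth_deriv (nat (l + m + p - k) - i) c)"
    proof (rule sum.reindex_bij_witness[of _ "\<lambda>i. l + m - int i" "\<lambda>s. nat (l + m - s)"])
      fix s assume s: "s \<in> {k-p..l+m}"
      have [simp]: "nat (l + m + p - k) - nat (l + m - s) = nat (s + p - k)" using s by auto
      show "fps_const ((of_int l gchoose nat (l + m - s)) * (of_int (l + m - int (nat (l + m - s))) gchoose (nat (l + m + p - k) - nat (l + m - s)))) *
         a * fps_nth_deriv (nat (l + m - s)) b * fps_nth_deriv (nat (l + m + p - k) - nat (l + m - s)) c =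
        fps_const (pc s (s + p - k)) * (fps_const (pc l (l + m - s)) * a *
         fps_nth_deriv (nat (l + m - s)) b) * fps_nth_deriv (nat (s + p - k)) c"
        using s by (simp add: pc_def mult_ac flip: fps_const_mult)
    qed (use False in auto)
    with False show ?thesis by simp
  qed auto
  finally show ?thesis .
qed

lemma assoc_key_right:
  fixes a b c :: "complex fps"
  assumes "lo \<le> k - l" "m + p \<le> hi"
  shows "(\<Sum>t\<in>{lo..hi}. fps_const (pc l (l + t - k)) * a * fps_nth_deriv (nat (l + t - k))
       (fps_const (pc m (m + p - t)) * b * fps_nth_deriv (nat (m + p - t)) c)) =
    (if l + m + p - k < 0 then 0 else
     \<Sum>i\<le>nat (l + m + p - k). fps_const ((of_int l gchoose i) * (of_int (l + m - int i) gchoose (nat (l + m + p - k) - i))) *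
       a * fps_nth_deriv i b * fps_nth_deriv (nat (l + m + p - k) - i) c)"
proof -
  have "(\<Sum>t\<in>{lo..hi}. fps_const (pc l (l + t - k)) * a * fps_nth_deriv (nat (l + t - k))
       (fps_const (pc m (m + p - t)) * b * fps_nth_deriv (nat (m + p - t)) c)) =
    (\<Sum>t\<in>{k-l..m+p}. fps_const (pc l (l + t - k)) * a * fps_nth_deriv (nat (l + t - k))
       (fps_const (pc m (m + p - t)) * b * fps_nth_deriv (nat (m + p - t)) c))"
    using assms by (intro sum.mono_neutral_right) (auto simp: pc_def)
  also have "\<dots> = (if l + m + p - k < 0 then 0 else
     \<Sum>i\<le>nat (l + m + p - k). fps_const ((of_int l gchoose i) * (of_int (l + m - int i) gchoose (nat (l + m + p - k) - i))) *
       a * fps_nth_deriv i b * fps_nth_deriv (nat (l + m + p - k) - i) c)"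
  proof (cases "l + m + p - k < 0")
    case False
    define n where "n = nat (l + m + p - k)"
    have n: "int n = l + m + p - k" using False by (simp add: n_def)
    have "(\<Sum>t\<in>{k-l..m+p}. fps_const (pc l (l + t - k)) * a * fps_nth_deriv (nat (l + t - k))
       (fps_const (pc m (m + p - t)) * b * fps_nth_deriv (nat (m + p - t)) c)) =
      (\<Sum>v\<le>n. fps_const (of_int l gchoose v) * a *
         fps_nth_deriv v (fps_const (of_int m gchoose (n - v)) * b * fps_nth_deriv (n - v) c))"
    proof (rule sum.reindex_bij_witness[of _ "\<lambda>v. int v + k - l" "\<lambda>t. nat (l + t - k)"])
      fix t assume t: "t \<in> {k-l..m+p}"
      have [simp]: "n - nat (l + t - k) = nat (m + p - t)" using t n by auto
      show "fps_const (of_int l gchoose nat (l + t - k)) * a *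
         fps_nth_deriv (nat (l + t - k)) (fps_const (of_int m gchoose (n - nat (l + t - k))) * b * fps_nth_deriv (n - nat (l + t - k)) c)
        = fps_const (pc l (l + t - k)) * a * fps_nth_deriv (nat (l + t - k))
       (fps_const (pc m (m + p - t)) * b * fps_nth_deriv (nat (m + p - t)) c)"
        using t by (simp add: pc_def)
    qed (use n in auto)
    also have "\<dots> = (\<Sum>v\<le>n. \<Sum>i\<le>v. fps_const ((of_int l gchoose v) * of_nat (v choose i) * (of_int m gchoose (n - v))) *
         (a * fps_nth_deriv i b * fps_nth_deriv (n - i) c))"
    proof (intro sum.cong refl)
      fix v assume v: "v \<in> {..n}"
      have "fps_nth_deriv v (fps_const (of_int m gchoose (n - v)) * b * fps_nth_deriv (n - v) c) =
         fps_const (of_int m gchoose (n - v)) * fps_nth_deriv v (b * fps_nth_deriv (n - v) c)"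
        by (simp add: mult.assoc)
      also have "\<dots> = (\<Sum>i\<le>v. fps_const (of_int m gchoose (n - v)) * (fps_const (of_nat (v choose i)) * fps_nth_deriv i b *
         fps_nth_deriv (n - i) c))"
        unfolding fps_nth_deriv_leibniz sum_distrib_left using v
        by (intro sum.cong refl) (auto simp: fps_nth_deriv_add_index)
      finally show "fps_const (of_int l gchoose v) * a *
         fps_nth_deriv v (fps_const (of_int m gchoose (n - v)) * b * fps_nth_deriv (n - v) c) =
        (\<Sum>i\<le>v. fps_const ((of_int l gchoose v) * of_nat (v choose i) * (of_int m gchoose (n - v))) *
         (a * fps_nth_deriv i b * fps_nth_deriv (n - i) c))"
        by (simp add: sum_distrib_left mult_ac flip: fps_const_mult)
    qed
    also have "\<dots> = (\<Sum>i\<le>n. \<Sum>v=i..n. fps_const ((of_int l gchoose v) * of_nat (v choose i) * (of_int m gchoose (n - v))) *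
         (a * fps_nth_deriv i b * fps_nth_deriv (n - i) c))"
      by (rule triangle_swap)
    also have "\<dots> = (\<Sum>i\<le>n. fps_const ((of_int l gchoose i) * (of_int (l + m - int i) gchoose (n - i))) *
       a * fps_nth_deriv i b * fps_nth_deriv (n - i) c)"
      by (intro sum.cong refl)
        (simp only: sum_distrib_right[symmetric] sum_fps_const pc_vandermonde atMost_iff,
         simp only: mult.assoc)
    finally show ?thesis using False by (simp add: n_def)
  qed auto
  finally show ?thesis .
qed

instance pdo :: ring_1
proof
  fix P Q R :: pdo
  show "P * Q * R = P * (Q * R)"
  proof (rule pdo_eqI)
    fix k
    obtain h where h: "\<And>m. m > h \<Longrightarrow> pdo_coeff P m = 0" "\<And>m. m > h \<Longrightarrow> pdo_coeff Q m = 0"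
      "\<And>m. m > h \<Longrightarrow> pdo_coeff R m = 0" "h \<ge> 0"
      using pdo_common_bound by blast
    define B where "B = {k - 2 * h..h}"
    define a where "a = pdo_coeff P"
    define b where "b = pdo_coeff Q"
    define c where "c = pdo_coeff R"
    note abc = a_def[symmetric] b_def[symmetric] c_def[symmetric]
    note h' = h[unfolded abc]
    have PQ: "pdo_prod_coeff a b m = 0" and QR: "pdo_prod_coeff b c m = 0" if "m > 2 * h" for m
      using that h' by (auto intro: pdo_prod_coeff_eq_0[of h _ h])
    have "pdo_coeff (P * Q * R) k = pdo_prod_coeff (pdo_prod_coeff a b) c k"
      by (simp add: times_pdo.rep_eq abc)
    also have "\<dots> = (\<Sum>s\<in>{k-h..2*h}. \<Sum>p\<in>B. fps_const (pc s (s + p - k)) * pdo_prod_coeff a b s *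
        fps_nth_deriv (nat (s + p - k)) (c p))"
      unfolding B_def by (rule pdo_prod_coeff_box) (use PQ h' in auto)
    also have "\<dots> = (\<Sum>s\<in>{k-h..2*h}. \<Sum>p\<in>B. \<Sum>l\<in>B. \<Sum>m\<in>B. fps_const (pc s (s + p - k)) *
        (fps_const (pc l (l + m - s)) * a l * fps_nth_deriv (nat (l + m - s)) (b m)) *
        fps_nth_deriv (nat (s + p - k)) (c p))"
    proof (intro sum.cong refl)
      fix s p assume s: "s \<in> {k-h..2*h}"
      have "pdo_prod_coeff a b s =
        (\<Sum>l\<in>B. \<Sum>m\<in>B. fps_const (pc l (l + m - s)) * a l * fps_nth_deriv (nat (l + m - s)) (b m))"
        unfolding B_def by (rule pdo_prod_coeff_box) (use s h' in auto)
      then show "fps_const (pc s (s + p - k)) * pdo_prod_coeff a b s * fps_nth_deriv (nat (s + p - k)) (c p) =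
        (\<Sum>l\<in>B. \<Sum>m\<in>B. fps_const (pc s (s + p - k)) *
        (fps_const (pc l (l + m - s)) * a l * fps_nth_deriv (nat (l + m - s)) (b m)) *
        fps_nth_deriv (nat (s + p - k)) (c p))"
        by (simp add: sum_distrib_left sum_distrib_right)
    qed
    also have "\<dots> = (\<Sum>p\<in>B. \<Sum>l\<in>B. \<Sum>m\<in>B. \<Sum>s\<in>{k-h..2*h}. fps_const (pc s (s + p - k)) *
        (fps_const (pc l (l + m - s)) * a l * fps_nth_deriv (nat (l + m - s)) (b m)) *
        fps_nth_deriv (nat (s + p - k)) (c p))"
      by (simp only: sum.swap[of _ _ "{k-h..2*h}"])
    finally have left: "pdo_coeff (P * Q * R) k = \<dots>" .

    have "pdo_coeff (P * (Q * R)) k = pdo_prod_coeff a (pdo_prod_coeff b c) k"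
      by (simp add: times_pdo.rep_eq abc)
    also have "\<dots> = (\<Sum>l\<in>B. \<Sum>t\<in>{k-h..2*h}. fps_const (pc l (l + t - k)) * a l *
        fps_nth_deriv (nat (l + t - k)) (pdo_prod_coeff b c t))"
      unfolding B_def by (rule pdo_prod_coeff_box) (use QR h' in auto)
    also have "\<dots> = (\<Sum>l\<in>B. \<Sum>t\<in>{k-h..2*h}. \<Sum>p\<in>B. \<Sum>m\<in>B. fps_const (pc l (l + t - k)) * a l *
        fps_nth_deriv (nat (l + t - k))
          (fps_const (pc m (m + p - t)) * b m * fps_nth_deriv (nat (m + p - t)) (c p)))"
    proof (intro sum.cong refl)
      fix l t assume t: "t \<in> {k-h..2*h}"
      have "pdo_prod_coeff b c t =
        (\<Sum>m\<in>B. \<Sum>p\<in>B. fps_const (pc m (m + p - t)) * b m * fps_nth_deriv (nat (m + p - t)) (c p))"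
        unfolding B_def by (rule pdo_prod_coeff_box) (use t h' in auto)
      also have "\<dots> = (\<Sum>p\<in>B. \<Sum>m\<in>B. fps_const (pc m (m + p - t)) * b m * fps_nth_deriv (nat (m + p - t)) (c p))"
        by (rule sum.swap)
      finally show "fps_const (pc l (l + t - k)) * a l *
        fps_nth_deriv (nat (l + t - k)) (pdo_prod_coeff b c t) =
        (\<Sum>p\<in>B. \<Sum>m\<in>B. fps_const (pc l (l + t - k)) * a l *
        fps_nth_deriv (nat (l + t - k))
          (fps_const (pc m (m + p - t)) * b m * fps_nth_deriv (nat (m + p - t)) (c p)))"
        by (simp add: sum_distrib_left fps_nth_deriv_sum)
    qed
    also have "\<dots> = (\<Sum>l\<in>B. \<Sum>p\<in>B. \<Sum>m\<in>B. \<Sum>t\<in>{k-h..2*h}. fps_const (pc l (l + t - k)) * a l *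
        fps_nth_deriv (nat (l + t - k))
          (fps_const (pc m (m + p - t)) * b m * fps_nth_deriv (nat (m + p - t)) (c p)))"
      by (simp only: sum.swap[of _ _ "{k-h..2*h}"])
    also have "\<dots> = (\<Sum>p\<in>B. \<Sum>l\<in>B. \<Sum>m\<in>B. \<Sum>t\<in>{k-h..2*h}. fps_const (pc l (l + t - k)) * a l *
        fps_nth_deriv (nat (l + t - k))
          (fps_const (pc m (m + p - t)) * b m * fps_nth_deriv (nat (m + p - t)) (c p)))"
      by (rule sum.swap)
    finally have right: "pdo_coeff (P * (Q * R)) k = \<dots>" .
    show "pdo_coeff (P * Q * R) k = pdo_coeff (P * (Q * R)) k"
      unfolding left right
    proof (rule sum.cong[OF refl], rule sum.cong[OF refl], rule sum.cong[OF refl])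
      fix p l m assume "p \<in> B" "l \<in> B" "m \<in> B"
      then have *: "k - h \<le> k - p" "l + m \<le> 2 * h" "k - h \<le> k - l" "m + p \<le> 2 * h"
        by (auto simp: B_def)
      show "(\<Sum>s\<in>{k-h..2*h}. fps_const (pc s (s + p - k)) *
        (fps_const (pc l (l + m - s)) * a l * fps_nth_deriv (nat (l + m - s)) (b m)) *
        fps_nth_deriv (nat (s + p - k)) (c p)) =
        (\<Sum>t\<in>{k-h..2*h}. fps_const (pc l (l + t - k)) * a l *
        fps_nth_deriv (nat (l + t - k))
          (fps_const (pc m (m + p - t)) * b m * fps_nth_deriv (nat (m + p - t)) (c p)))"
        by (simp only: assoc_key_left[OF *(1,2)] assoc_key_right[OF *(3,4)])
    qed
  qed
  show "(P + Q) * R = P * R + Q * R"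
  proof (rule pdo_eqI)
    fix k
    obtain h where h: "\<And>m. m > h \<Longrightarrow> pdo_coeff P m = 0" "\<And>m. m > h \<Longrightarrow> pdo_coeff Q m = 0"
      "\<And>m. m > h \<Longrightarrow> pdo_coeff R m = 0" "h \<ge> 0"
      using pdo_common_bound by blast
    have *: "pdo_coeff (X * R) k = (\<Sum>l\<in>{k-h..h}. \<Sum>m\<in>{k-h..h}. fps_const (pc l (l + m - k)) *
        pdo_coeff X l * fps_nth_deriv (nat (l + m - k)) (pdo_coeff R m))"
      if "\<And>m. m > h \<Longrightarrow> pdo_coeff X m = 0" for X
      unfolding times_pdo.rep_eq by (rule pdo_prod_coeff_box) (use that h in auto)
    show "pdo_coeff ((P + Q) * R) k = pdo_coeff (P * R + Q * R) k"
      using h by (simp add: * sum.distrib algebra_simps)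
  qed
  show "P * (Q + R) = P * Q + P * R"
  proof (rule pdo_eqI)
    fix k
    obtain h where h: "\<And>m. m > h \<Longrightarrow> pdo_coeff P m = 0" "\<And>m. m > h \<Longrightarrow> pdo_coeff Q m = 0"
      "\<And>m. m > h \<Longrightarrow> pdo_coeff R m = 0" "h \<ge> 0"
      using pdo_common_bound by blast
    have *: "pdo_coeff (P * X) k = (\<Sum>l\<in>{k-h..h}. \<Sum>m\<in>{k-h..h}. fps_const (pc l (l + m - k)) *
        pdo_coeff P l * fps_nth_deriv (nat (l + m - k)) (pdo_coeff X m))"
      if "\<And>m. m > h \<Longrightarrow> pdo_coeff X m = 0" for X
      unfolding times_pdo.rep_eq by (rule pdo_prod_coeff_box) (use that h in auto)
    show "pdo_coeff (P * (Q + R)) k = pdo_coeff (P * Q + P * R) k"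
      using h by (simp add: * sum.distrib algebra_simps)
  qed
  show "1 * P = P"
  proof (rule pdo_eqI)
    fix k
    have "pdo_coeff (1 * P) k = (\<Sum>(l, m)\<in>(if pdo_coeff P k = 0 then {} else {(0, k)}).
        fps_const (of_int l gchoose nat (l + m - k)) * pdo_coeff 1 l *
        fps_nth_deriv (nat (l + m - k)) (pdo_coeff P m))"
      unfolding times_pdo.rep_eq pdo_prod_coeff_def
    proof (rule sum.mono_neutral_right)
      show "finite {(l, m). pdo_coeff 1 l \<noteq> 0 \<and> pdo_coeff P m \<noteq> 0 \<and> k \<le> l + m}"
      proof -
        obtain N where N: "\<forall>m>N. pdo_coeff P m = 0" using pdo_coeff_bounded by blast
        have "{(l, m). pdo_coeff 1 l \<noteq> 0 \<and> pdo_coeff P m \<noteq> 0 \<and> k \<le> l + m} \<subseteq> {0} \<times> {k..N}"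
          using N by (auto simp: one_pdo.rep_eq split: if_splits) (meson not_le)
        then show ?thesis by (rule finite_subset) simp
      qed
    qed (auto simp: one_pdo.rep_eq gbinomial_0_left split: if_splits)
    then show "pdo_coeff (1 * P) k = pdo_coeff P k"
      by (auto simp: one_pdo.rep_eq split: if_splits)
  qed
  show "P * 1 = P"
  proof (rule pdo_eqI)
    fix k
    have "pdo_coeff (P * 1) k = (\<Sum>(l, m)\<in>(if pdo_coeff P k = 0 then {} else {(k, 0)}).
        fps_const (of_int l gchoose nat (l + m - k)) * pdo_coeff P l *
        fps_nth_deriv (nat (l + m - k)) (pdo_coeff 1 m))"
      unfolding times_pdo.rep_eq pdo_prod_coeff_def
    proof (rule sum.mono_neutral_right)
      show "finite {(l, m). pdo_coeff P l \<noteq> 0 \<and> pdo_coeff 1 m \<noteq> 0 \<and> k \<le> l + m}"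
      proof -
        obtain N where N: "\<forall>m>N. pdo_coeff P m = 0" using pdo_coeff_bounded by blast
        have "{(l, m). pdo_coeff P l \<noteq> 0 \<and> pdo_coeff 1 m \<noteq> 0 \<and> k \<le> l + m} \<subseteq> {k..N} \<times> {0}"
          using N by (auto simp: one_pdo.rep_eq split: if_splits) (meson not_le)
        then show ?thesis by (rule finite_subset) simp
      qed
    qed (auto simp: one_pdo.rep_eq split: if_splits)
    then show "pdo_coeff (P * 1) k = pdo_coeff P k"
      by (auto simp: one_pdo.rep_eq split: if_splits)
  qed
  show "(0::pdo) \<noteq> 1"
    by (metis one_neq_zero one_pdo.rep_eq pdo_coeff_0)
qed

section \<open>Right coefficients and adjoints\<close>

lift_definition pdo_monom :: "complex fps \<Rightarrow> int \<Rightarrow> pdo" is "\<lambda>a m j. if j = m then a else 0"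
  by (auto simp: bounded_order_def)

text \<open>\<open>pdo_right_sum b\<close> is \<open>\<Sum>\<^sub>m \<partial>\<^sup>m \<cdot> b\<^sub>m(x)\<close>, for \<open>b\<close> of bounded order. As \<open>\<partial>\<^sup>m \<cdot> b\<^sub>m(x)\<close> has order at
  most \<open>m\<close>, only the terms with \<open>k \<le> m\<close> contribute to the coefficient of \<open>\<partial>\<^sup>k\<close>.\<close>

definition pdo_right_sum :: "(int \<Rightarrow> complex fps) \<Rightarrow> pdo" where
  "pdo_right_sum b =
     Abs_pdo (\<lambda>k. \<Sum>m | b m \<noteq> 0 \<and> k \<le> m. pdo_coeff (pdo_monom 1 m * pdo_monom (b m) 0) k)"

definition pdo_right_coeff :: "pdo \<Rightarrow> int \<Rightarrow> complex fps" where
  "pdo_right_coeff P = (THE b. bounded_order b \<and> P = pdo_right_sum b)"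

definition pdo_adjoint :: "pdo \<Rightarrow> pdo" where
  "pdo_adjoint P = pdo_right_sum (\<lambda>l. fps_compose (pdo_coeff P l) (- fps_X))"

lemma pdo_coeff_monom_mult:
  "pdo_coeff (pdo_monom 1 m * pdo_monom b 0) k =
    (if k \<le> m then fps_const (of_int m gchoose nat (m - k)) * fps_nth_deriv (nat (m - k)) b else 0)"
proof -
  have "{(l, j). pdo_coeff (pdo_monom 1 m) l \<noteq> 0 \<and> pdo_coeff (pdo_monom b 0) j \<noteq> 0 \<and> k \<le> l + j} =
    (if k \<le> m \<and> b \<noteq> 0 then {(m, 0)} else {})"
    by (auto simp: pdo_monom.rep_eq split: if_splits)
  then show ?thesis
    by (auto simp: times_pdo.rep_eq pdo_prod_coeff_def pdo_monom.rep_eq)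
qed

text \<open>Auxiliary: for \<open>e = 1\<close> the passage from right to left coefficients, for \<open>e = -1\<close> its inverse
  (\<open>rconv_rconv\<close>).\<close>

definition rconv :: "complex \<Rightarrow> int \<Rightarrow> (int \<Rightarrow> complex fps) \<Rightarrow> int \<Rightarrow> complex fps" where
  "rconv e h a k = (\<Sum>m\<in>{k..h}. fps_const (e ^ nat (m - k) * (of_int m gchoose nat (m - k))) *
     fps_nth_deriv (nat (m - k)) (a m))"

lemma rconv_coeff_sum:
  "(\<Sum>i\<le>n. e ^ i * (of_int (k + int i) gchoose i) * (e' ^ (n - i) * (of_int (k + int n) gchoose (n - i)))) =
    (of_int (k + int n) gchoose n) * (e + e' :: complex) ^ n"
proof -
  have "(\<Sum>i\<le>n. e ^ i * (of_int (k + int i) gchoose i) * (e' ^ (n - i) * (of_int (k + int n) gchoose (n - i)))) =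
    (\<Sum>i\<le>n. ((of_int (k + int n) :: complex) gchoose n) * (of_nat (n choose i) * e ^ i * e' ^ (n - i)))"
  proof (intro sum.cong refl)
    fix i assume "i \<in> {..n}"
    then have i: "n - i \<le> n" "n - (n - i) = i" "n choose (n - i) = n choose i"
      by (auto intro: binomial_symmetric[symmetric])
    have "((of_int (k + int n) :: complex) gchoose n) * of_nat (n choose i) =
      (of_int (k + int n) gchoose (n - i)) * (of_int (k + int n) - of_nat (n - i) gchoose i)"
      using gbinomial_trinomial_revision[OF i(1), of "of_int (k + int n) :: complex"] i(2,3)
      by (simp add: binomial_gbinomial[symmetric])
    also have "of_int (k + int n) - of_nat (n - i) = (of_int (k + int i) :: complex)"
      using \<open>i \<in> {..n}\<close> by (simp add: of_nat_diff)
    finally show "e ^ i * (of_int (k + int i) gchoose i) * (e' ^ (n - i) * (of_int (k + int n) gchoose (n - i))) =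
      ((of_int (k + int n) :: complex) gchoose n) * (of_nat (n choose i) * e ^ i * e' ^ (n - i))"
      by (simp add: mult_ac)
  qed
  then show ?thesis by (simp add: sum_distrib_left[symmetric] binomial_ring)
qed

lemma rconv_rconv:
  assumes "e + e' = 0" "\<And>m. m > h \<Longrightarrow> a m = 0"
  shows "rconv e h (rconv e' h a) k = a k"
proof (cases "k \<le> h")
  case False
  then show ?thesis using assms by (simp add: rconv_def)
next
  case True
  define t where "t s m = fps_const (e ^ nat (s - k) * (of_int s gchoose nat (s - k)) *
      (e' ^ nat (m - s) * (of_int m gchoose nat (m - s)))) * fps_nth_deriv (nat (m - k)) (a m)" for s m
  have "rconv e h (rconv e' h a) k = (\<Sum>s\<in>{k..h}. \<Sum>m | m \<in> {k..h} \<and> s \<le> m. t s m)"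
    unfolding rconv_def[of e]
  proof (intro sum.cong refl)
    fix s assume s: "s \<in> {k..h}"
    have "fps_nth_deriv (nat (s - k)) (rconv e' h a s) =
      (\<Sum>m\<in>{s..h}. fps_const (e' ^ nat (m - s) * (of_int m gchoose nat (m - s))) * fps_nth_deriv (nat (m - k)) (a m))"
      unfolding rconv_def fps_nth_deriv_sum
      using s by (intro sum.cong refl)
        (auto simp: fps_nth_deriv_add_index nat_add_distrib[symmetric] simp del: fps_const_mult)
    moreover have "{m. m \<in> {k..h} \<and> s \<le> m} = {s..h}" using s by auto
    ultimately show "fps_const (e ^ nat (s - k) * (of_int s gchoose nat (s - k))) *
        fps_nth_deriv (nat (s - k)) (rconv e' h a s) = (\<Sum>m | m \<in> {k..h} \<and> s \<le> m. t s m)"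
      by (simp add: t_def sum_distrib_left mult_ac flip: fps_const_mult)
  qed
  also have "\<dots> = (\<Sum>m\<in>{k..h}. \<Sum>s | s \<in> {k..h} \<and> s \<le> m. t s m)"
    by (rule sum.swap_restrict) auto
  also have "\<dots> = (\<Sum>m\<in>{k..h}. if m = k then a k else 0)"
  proof (intro sum.cong refl)
    fix m assume m: "m \<in> {k..h}"
    define n where "n = nat (m - k)"
    have n: "m = k + int n" using m by (simp add: n_def)
    have "(\<Sum>s | s \<in> {k..h} \<and> s \<le> m. t s m) = (\<Sum>i\<le>n. t (k + int i) m)"
      using m n by (intro sum.reindex_bij_witness[of _ "\<lambda>i. k + int i" "\<lambda>s. nat (s - k)"]) auto
    also have "\<dots> = (\<Sum>i\<le>n. fps_const (e ^ i * (of_int (k + int i) gchoose i) *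
       (e' ^ (n - i) * (of_int (k + int n) gchoose (n - i)))) * fps_nth_deriv n (a m))"
    proof (intro sum.cong refl)
      fix i assume "i \<in> {..n}"
      then have "nat (m - (k + int i)) = n - i" using n by auto
      then show "t (k + int i) m = fps_const (e ^ i * (of_int (k + int i) gchoose i) *
       (e' ^ (n - i) * (of_int (k + int n) gchoose (n - i)))) * fps_nth_deriv n (a m)"
        unfolding t_def using n by simp
    qed
    also have "\<dots> = fps_const ((of_int (k + int n) gchoose n) * (e + e') ^ n) * fps_nth_deriv n (a m)"
      by (simp only: sum_distrib_right[symmetric] sum_fps_const rconv_coeff_sum)
    also have "\<dots> = (if m = k then a k else 0)"
      using assms(1) n by (auto simp: power_0_left)
    finally show "(\<Sum>s | s \<in> {k..h} \<and> s \<le> m. t s m) = (if m = k then a k else 0)" .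
  qed
  also have "\<dots> = a k" using True by simp
  finally show ?thesis .
qed

lemma pdo_coeff_right_sum:
  assumes "\<And>m. m > h \<Longrightarrow> b m = 0"
  shows "pdo_coeff (pdo_right_sum b) k = rconv 1 h b k"
proof -
  have *: "(\<lambda>k. \<Sum>m | b m \<noteq> 0 \<and> k \<le> m. pdo_coeff (pdo_monom 1 m * pdo_monom (b m) 0) k) = rconv 1 h b"
  proof
    fix k
    show "(\<Sum>m | b m \<noteq> 0 \<and> k \<le> m. pdo_coeff (pdo_monom 1 m * pdo_monom (b m) 0) k) = rconv 1 h b k"
      unfolding rconv_def
    proof (rule sum.mono_neutral_cong_left)
      show "{m. b m \<noteq> 0 \<and> k \<le> m} \<subseteq> {k..h}" using assms by (auto intro: ccontr)
    qed (auto simp: pdo_coeff_monom_mult)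
  qed
  have "bounded_order (rconv 1 h b)"
    unfolding bounded_order_def by (intro exI[of _ h]) (simp add: rconv_def)
  then show ?thesis unfolding pdo_right_sum_def * by (simp add: Abs_pdo_inverse)
qed

text \<open>Every operator can be written in exactly one way with coefficients on the right.\<close>

lemma pdo_right_coeff_ex1: "\<exists>!b. bounded_order b \<and> P = pdo_right_sum b"
proof -
  obtain h where h: "\<And>m. m > h \<Longrightarrow> pdo_coeff P m = 0" using pdo_coeff_bounded by blast
  let ?b = "rconv (-1) h (pdo_coeff P)"
  have b0: "?b m = 0" if "m > h" for m using that by (simp add: rconv_def)
  show ?thesis
  proof (rule ex1I[of _ ?b], intro conjI)
    show "bounded_order ?b" unfolding bounded_order_def using b0 by blast
    show "P = pdo_right_sum ?b"
      by (rule pdo_eqI) (simp add: pdo_coeff_right_sum[OF b0] rconv_rconv h)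
  next
    fix c assume c: "bounded_order c \<and> P = pdo_right_sum c"
    then obtain g where g: "\<forall>m>g. c m = 0" by (auto simp: bounded_order_def)
    define N where "N = max g h"
    have c0: "c m = 0" if "m > N" for m using that g by (simp add: N_def)
    have "pdo_coeff P = rconv 1 N c"
      using c by (auto simp: pdo_coeff_right_sum[OF c0])
    then have 1: "rconv (-1) N (pdo_coeff P) = c"
      using c0 by (auto simp: rconv_rconv)
    have "rconv (-1) N (pdo_coeff P) = ?b"
      unfolding rconv_def using h
      by (intro ext sum.mono_neutral_right) (auto simp: N_def)
    with 1 show "c = ?b" by simp
  qed
qed

section \<open>The action on Laurent series\<close>

text \<open>Elements of \<open>\<complex>((\<partial>\<^sup>-\<^sup>1))\<close> are Laurent series in the variable \<open>\<partial>\<^sup>-\<^sup>1\<close>, so the coefficient of \<open>\<partial>\<^sup>m\<close>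
  has index \<open>-m\<close>.\<close>

definition fls_to_pdo :: "complex fls \<Rightarrow> pdo" where
  "fls_to_pdo f = Abs_pdo (\<lambda>m. fps_const (fls_nth f (- m)))"

definition pdo_rho :: "pdo \<Rightarrow> complex fls" where
  "pdo_rho P = Abs_fls (\<lambda>k. fps_nth (pdo_right_coeff P (- k)) 0)"

lemma pdo_coeff_fls_to_pdo [simp]: "pdo_coeff (fls_to_pdo f) m = fps_const (fls_nth f (- m))"
proof -
  have "bounded_order (\<lambda>m. fps_const (fls_nth f (- m)))"
    unfolding bounded_order_def by (intro exI[of _ "- fls_subdegree f"]) auto
  then show ?thesis by (simp add: fls_to_pdo_def Abs_pdo_inverse)
qed

lemma fls_nth_pdo_rho [simp]: "fls_nth (pdo_rho P) k = fps_nth (pdo_right_coeff P (- k)) 0"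
proof -
  have "bounded_order (pdo_right_coeff P)"
    unfolding pdo_right_coeff_def using theI'[OF pdo_right_coeff_ex1[of P]] by blast
  then obtain N where "\<forall>m>N. pdo_right_coeff P m = 0" by (auto simp: bounded_order_def)
  then show ?thesis
    unfolding pdo_rho_def by (intro nth_Abs_fls_lower_bound[of "- N"]) auto
qed

text \<open>The identification \<open>f(z) \<leftrightarrow> f(\<partial>\<^sup>-\<^sup>1) \<partial>\<^sup>-\<^sup>1\<close> is multiplication by the variable.\<close>

definition pdo_act :: "pdo \<Rightarrow> complex fls \<Rightarrow> complex fls" where
  "pdo_act P f = pdo_rho (P * fls_to_pdo (f * fls_X)) * fls_X_inv"

definition pdo_mat_act :: "pdo^'n^'n \<Rightarrow> complex fls^'n \<Rightarrow> complex fls^'n" where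
  "pdo_mat_act P f = (\<chi> i. \<Sum>j\<in>UNIV. pdo_act (P $ i $ j) (f $ j))"

definition pdo_mat_adjoint :: "pdo^'n^'n \<Rightarrow> pdo^'n^'n" where
  "pdo_mat_adjoint P = (\<chi> i j. pdo_adjoint (P $ j $ i))"

definition monic_order_0 :: "(pdo^'n^'n) set" where
  "monic_order_0 = {mat 1 + T | T. \<forall>i j. \<forall>m\<ge>0. pdo_coeff (T $ i $ j) m = 0}"

section \<open>The Sato Grassmannian\<close>

definition laurent_scale :: "complex \<Rightarrow> complex fls^'n \<Rightarrow> complex fls^'n" where
  "laurent_scale c f = (\<chi> i. fls_const c * f $ i)"

global_interpretation laurent: vector_space "laurent_scale :: complex \<Rightarrow> complex fls^'n \<Rightarrow> _"
  by standard (simp_all add: laurent_scale_def vec_eq_iff algebra_simps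
    flip: fls_plus_const fls_const_mult_const)

definition power_series_vectors :: "(complex fls^'n) set" where
  "power_series_vectors = {f. \<forall>i. f $ i \<in> range fps_to_fls}"

text \<open>The natural map to \<open>\<complex>((z))\<^sup>n / \<complex>[[z]]\<^sup>n\<close>, whose elements are cosets.\<close>

definition mod_power_series :: "complex fls^'n \<Rightarrow> (complex fls^'n) set" where
  "mod_power_series f = {f + g | g. g \<in> power_series_vectors}"

text \<open>A space is finite-dimensional if it is spanned by a finite set. For the cokernel of
  \<open>\<gamma>\<^sub>W\<close>, the finite spanning set is given by representatives in \<open>\<complex>((z))\<^sup>n\<close>.\<close>

definition fin_dim_kernel :: "(complex fls^'n) set \<Rightarrow> bool" where
  "fin_dim_kernel W \<longleftrightarrow>
     (\<exists>B. finite B \<and> {w \<in> W. mod_power_series w = mod_power_series 0} = laurent.span B)"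

definition fin_dim_cokernel :: "(complex fls^'n) set \<Rightarrow> bool" where
  "fin_dim_cokernel W \<longleftrightarrow>
     (\<exists>B. finite B \<and>
       (\<forall>f. \<exists>b\<in>laurent.span B. \<exists>w\<in>W. mod_power_series f = mod_power_series (b + w)))"

definition Grassmannian :: "(complex fls^'n) set set" where
  "Grassmannian = {W. laurent.subspace W \<and> fin_dim_kernel W \<and> fin_dim_cokernel W}"

definition big_cell :: "(complex fls^'n) set set" where
  "big_cell = {W \<in> Grassmannian. bij_betw mod_power_series W (range mod_power_series)}"

definition residue_pairing :: "complex fls^'n \<Rightarrow> complex fls^'n \<Rightarrow> complex" where
  "residue_pairing f h = (\<Sum>i\<in>UNIV. fls_nth (f $ i * h $ i) (-1))"

definition perp :: "(complex fls^'n) set \<Rightarrow> (complex fls^'n) set" where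
  "perp W = {f. \<forall>w\<in>W. residue_pairing f w = 0}"

text \<open>\<open>\<complex>[z\<^sup>-\<^sup>1]\<^sup>n \<cdot> z\<^sup>-\<^sup>1\<close>\<close>

definition polynomial_part :: "(complex fls^'n) set" where
  "polynomial_part =
     {f. \<forall>i. \<exists>p :: complex poly. f $ i = poly (map_poly fls_const p) fls_X_inv * fls_X_inv}"

definition corresponds :: "pdo^'n^'n \<Rightarrow> (complex fls^'n) set \<Rightarrow> bool" where
  "corresponds S W \<longleftrightarrow>
     S \<in> monic_order_0 \<and> W \<in> big_cell \<and> W = pdo_mat_act (matrix_inv S) ` polynomial_part"

end

theory Submission
  imports Defs
begin

text \<open>The adjoint is the transpose for the residue pairing, \<open>\<langle>P \<cdot> f, g\<rangle> = \<langle>f, P\<^sup>* \<cdot> g\<rangle>\<close>. This can be read off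
  the matrix entries of the action on the basis \<open>z\<^sup>k\<close>, so it does not need the fact that \<open>P \<mapsto> P\<^sup>*\<close> is an
  anti-automorphism. Since \<open>H = \<complex>[z\<^sup>-\<^sup>1]\<^sup>n z\<^sup>-\<^sup>1\<close> is its own orthogonal complement and
  \<open>\<langle>S\<^sup>* \<cdot> g, S\<^sup>-\<^sup>1 \<cdot> w\<rangle> = \<langle>g, w\<rangle>\<close>, the orthogonal complement of \<open>W = S\<^sup>-\<^sup>1 \<cdot> H\<close> is \<open>S\<^sup>* \<cdot> H\<close>. Monic operators
  of order zero are invertible by the Neumann series, and they preserve \<open>\<complex>[[z]]\<^sup>n\<close>, so \<open>S\<^sup>* \<cdot> H\<close> is a
  complement of \<open>\<complex>[[z]]\<^sup>n\<close>, like \<open>H\<close>.\<close>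

section \<open>The order filtration on operators\<close>

lemma pdo_coeff_diff: "pdo_coeff (P - Q) m = pdo_coeff P m - pdo_coeff Q m"
  by (simp only: minus_pdo_def pdo_coeff_add pdo_coeff_uminus) simp

text \<open>An upper bound rather than the exact order: 0 satisfies it for every \<open>h\<close>,
  and several operators can share one summation range.\<close>

definition order_le :: "pdo \<Rightarrow> int \<Rightarrow> bool" where
  "order_le P h \<longleftrightarrow> (\<forall>m>h. pdo_coeff P m = 0)"

lemma order_leD: "order_le P h \<Longrightarrow> h < m \<Longrightarrow> pdo_coeff P m = 0"
  by (simp add: order_le_def)

lemma order_le_exists: "\<exists>h. order_le P h"
  using pdo_coeff_bounded by (simp add: order_le_def)

lemma order_le_mono: "order_le P h \<Longrightarrow> h \<le> h' \<Longrightarrow> order_le P h'"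
  by (simp add: order_le_def)

lemma order_le_0 [simp]: "order_le 0 h"
  by (simp add: order_le_def)

lemma order_le_add: "order_le P h \<Longrightarrow> order_le Q h \<Longrightarrow> order_le (P + Q) h"
  by (simp add: order_le_def)

lemma order_le_uminus: "order_le P h \<Longrightarrow> order_le (- P) h"
  by (simp add: order_le_def)

lemma order_le_diff: "order_le P h \<Longrightarrow> order_le Q h \<Longrightarrow> order_le (P - Q) h"
  using order_le_add[OF _ order_le_uminus] by fastforce

lemma order_le_sum: "(\<And>i. i \<in> A \<Longrightarrow> order_le (f i) h) \<Longrightarrow> order_le (sum f A) h"
  by (induction A rule: infinite_finite_induct) (auto intro: order_le_add)

lemma order_le_mult: "order_le P p \<Longrightarrow> order_le Q q \<Longrightarrow> order_le (P * Q) (p + q)"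
  unfolding order_le_def times_pdo.rep_eq by (blast intro: pdo_prod_coeff_eq_0)

lemma order_le_one: "order_le 1 0"
  by (simp add: order_le_def one_pdo.rep_eq)

section \<open>The action as a module structure\<close>

lemma pdo_right_coeff_eqI:
  assumes "bounded_order b" "P = pdo_right_sum b"
  shows "pdo_right_coeff P = b"
  unfolding pdo_right_coeff_def
  by (rule the1_equality[OF pdo_right_coeff_ex1]) (use assms in auto)

lemma bounded_order_pdo_right_coeff: "bounded_order (pdo_right_coeff P)"
  and pdo_right_sum_right_coeff: "pdo_right_sum (pdo_right_coeff P) = P"
  using theI'[OF pdo_right_coeff_ex1[of P]] unfolding pdo_right_coeff_def by auto

text \<open>\<open>rconv (-1) h\<close> inverts the passage \<open>rconv 1 h\<close> from right to
  left coefficients; any bound \<open>h\<close> on the order may be used.\<close>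

lemma pdo_right_coeff_rconv:
  assumes "order_le P h"
  shows "pdo_right_coeff P = rconv (-1) h (pdo_coeff P)"
proof (rule pdo_right_coeff_eqI)
  have b0: "rconv (-1) h (pdo_coeff P) m = 0" if "m > h" for m
    using that by (simp add: rconv_def)
  show "bounded_order (rconv (-1) h (pdo_coeff P))"
    unfolding bounded_order_def using b0 by blast
  show "P = pdo_right_sum (rconv (-1) h (pdo_coeff P))"
    by (rule pdo_eqI) (simp add: pdo_coeff_right_sum[OF b0] rconv_rconv order_leD[OF assms])
qed

text \<open>With j = m + k, rewriting a_m(x) \<partial>^m with right coefficients contributes (-1)^j
  C(m,j) a_m^(j)(0) to \<partial>^(-k). Upper negation turns (-1)^j C(j-k,j) into C(k-1,j). Terms
  above the order vanish, so any large enough \<open>n\<close> serves.\<close>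

lemma pdo_rho_nth:
  assumes "order_le P h" "h + k \<le> int n"
  shows "fls_nth (pdo_rho P) k =
    (\<Sum>j\<le>n. fact j * (of_int (k - 1) gchoose j) * fps_nth (pdo_coeff P (int j - k)) j)"
proof -
  have "fls_nth (pdo_rho P) k =
    (\<Sum>m\<in>{-k..h}. (-1) ^ nat (m + k) * (of_int m gchoose nat (m + k)) *
      (fact (nat (m + k)) * fps_nth (pdo_coeff P m) (nat (m + k))))"
    by (simp add: pdo_right_coeff_rconv[OF assms(1)] rconv_def fps_sum_nth
      fps_deriv_maclauren_0 mult.assoc)
  also have "\<dots> = (\<Sum>m\<in>{-k..int n - k}. (-1) ^ nat (m + k) * (of_int m gchoose nat (m + k)) *
      (fact (nat (m + k)) * fps_nth (pdo_coeff P m) (nat (m + k))))"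
    using assms by (intro sum.mono_neutral_left) (auto simp: order_leD)
  also have "\<dots> = (\<Sum>j\<le>n. (-1) ^ j * (of_int (int j - k) gchoose j) *
      (fact j * fps_nth (pdo_coeff P (int j - k)) j))"
    by (intro sum.reindex_bij_witness[of _ "\<lambda>j. int j - k" "\<lambda>m. nat (m + k)"]) auto
  also have "\<dots> = (\<Sum>j\<le>n. fact j * (of_int (k - 1) gchoose j) * fps_nth (pdo_coeff P (int j - k)) j)"
    by (simp add: gbinomial_negated_upper[of "of_int k - 1"] mult_ac)
  finally show ?thesis .
qed

lemma pdo_rho_add: "pdo_rho (P + Q) = pdo_rho P + pdo_rho Q"
proof (rule fls_eqI)
  fix k
  obtain h where h: "order_le P h" "order_le Q h"
    by (metis pdo_common_bound order_le_def)
  define n where "n = nat (h + k)"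
  have n: "h + k \<le> int n" by (simp add: n_def)
  show "fls_nth (pdo_rho (P + Q)) k = fls_nth (pdo_rho P + pdo_rho Q) k"
    unfolding fls_plus_nth pdo_rho_nth[OF h(1) n] pdo_rho_nth[OF h(2) n]
      pdo_rho_nth[OF order_le_add[OF h] n]
    by (simp add: algebra_simps sum.distrib)
qed

text \<open>Constant coefficients commute with \<partial>, so only the term \<open>j = 0\<close>
  survives.\<close>

lemma pdo_rho_fls_to_pdo: "pdo_rho (fls_to_pdo f) = f"
proof (rule fls_eqI)
  fix k
  have "order_le (fls_to_pdo f) (- fls_subdegree f)"
    by (auto simp: order_le_def)
  then have "fls_nth (pdo_rho (fls_to_pdo f)) k = (\<Sum>j\<le>nat (k - fls_subdegree f).
      fact j * (of_int (k - 1) gchoose j) * fps_nth (pdo_coeff (fls_to_pdo f) (int j - k)) j)"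
    by (rule pdo_rho_nth) simp
  also have "\<dots> = (\<Sum>j\<le>nat (k - fls_subdegree f). if j = 0 then fls_nth f k else 0)"
    by (intro sum.cong) auto
  finally show "fls_nth (pdo_rho (fls_to_pdo f)) k = fls_nth f k"
    by (simp del: fls_nth_pdo_rho)
qed

section \<open>The left ideal generated by x and the passage to the quotient\<close>

lemma fps_nth_deriv_mult_X:
  "fps_nth_deriv n (c * fps_X) = fps_nth_deriv n c * fps_X + of_nat n * fps_nth_deriv (n - 1) c"
  for c :: "complex fps"
proof (induction n arbitrary: c)
  case (Suc n)
  then show ?case
    by (cases n) (auto simp: algebra_simps)
qed simp

text \<open>From \<partial>^l x = x \<partial>^l + l \<partial>^(l-1): only l = k and l = k + 1
  contribute to \<partial>^k.\<close>

lemma pdo_coeff_mult_X: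
  "pdo_coeff (P * pdo_monom fps_X 0) k =
    pdo_coeff P k * fps_X + of_int (k + 1) * pdo_coeff P (k + 1)"
proof -
  obtain h where h: "order_le P h" using order_le_exists by blast
  \<comment> \<open>The maximum keeps \<open>k + 1\<close> in the range even when \<open>h\<close>
    is smaller.\<close>
  define p where "p = max h (k + 1)"
  let ?t = "\<lambda>l. fps_const (pc l (l - k)) * pdo_coeff P l * fps_nth_deriv (nat (l - k)) fps_X"
  have "pdo_coeff (P * pdo_monom fps_X 0) k = (\<Sum>l\<in>{k..p}. \<Sum>m\<in>{k-p..0}.
      fps_const (pc l (l + m - k)) * pdo_coeff P l *
      fps_nth_deriv (nat (l + m - k)) (pdo_coeff (pdo_monom fps_X 0) m))"
    unfolding times_pdo.rep_eq
    by (rule pdo_prod_coeff_box) (use h in \<open>auto simp: p_def order_le_def pdo_monom.rep_eq\<close>)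
  also have "\<dots> = (\<Sum>l\<in>{k..p}. \<Sum>m\<in>{k-p..0}. if m = 0 then ?t l else 0)"
    by (intro sum.cong) (auto simp: pdo_monom.rep_eq)
  also have "\<dots> = (\<Sum>l\<in>{k..p}. ?t l)"
    by (simp add: p_def)
  also have "\<dots> = (\<Sum>l\<in>{k, k + 1}. ?t l)"
    by (rule sum.mono_neutral_right) (auto simp: p_def)
  also have "\<dots> = pdo_coeff P k * fps_X + of_int (k + 1) * pdo_coeff P (k + 1)"
    by (simp add: pc_def algebra_simps fps_of_int[symmetric] flip: fps_const_add)
  finally show ?thesis .
qed

text \<open>Right multiplication by x acts on each right coefficient separately. As the sum may be
  infinite, the proof compares left coefficients and expands the derivatives by the Leibniz
  rule.\<close>

lemma pdo_right_sum_mult_X: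
  assumes "bounded_order c"
  shows "pdo_right_sum (\<lambda>m. c m * fps_X) = pdo_right_sum c * pdo_monom fps_X 0"
proof (rule pdo_eqI)
  fix k
  obtain h where h: "\<And>m. m > h \<Longrightarrow> c m = 0"
    using assms by (auto simp: bounded_order_def)
  let ?g = "\<lambda>m. (of_int m :: complex) gchoose nat (m - k)"
  have "rconv 1 h (\<lambda>m. c m * fps_X) k =
    (\<Sum>m\<in>{k..h}. fps_const (?g m) * fps_nth_deriv (nat (m - k)) (c m)) * fps_X +
    (\<Sum>m\<in>{k..h}. fps_const (?g m) * (of_nat (nat (m - k)) * fps_nth_deriv (nat (m - k) - 1) (c m)))"
    by (simp only: rconv_def fps_nth_deriv_mult_X distrib_left sum.distrib sum_distrib_right
      power_one mult_1_left mult.assoc)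
  also have "(\<Sum>m\<in>{k..h}. fps_const (?g m) * (of_nat (nat (m - k)) * fps_nth_deriv (nat (m - k) - 1) (c m))) =
    (\<Sum>m\<in>{k+1..h}. fps_const (?g m) * (of_nat (nat (m - k)) * fps_nth_deriv (nat (m - k) - 1) (c m)))"
    by (rule sum.mono_neutral_right) (auto simp: not_le zless_add1_eq)
  also have "\<dots> = (\<Sum>m\<in>{k+1..h}. of_int (k + 1) *
    (fps_const (of_int m gchoose nat (m - (k + 1))) * fps_nth_deriv (nat (m - (k + 1))) (c m)))"
  proof (rule sum.cong)
    fix m assume "m \<in> {k+1..h}"
    define j where "j = nat (m - (k + 1))"
    have j: "nat (m - k) = Suc j" "nat (m - (k + 1)) = j" "m = k + 1 + int j"
      using \<open>m \<in> {k+1..h}\<close> by (auto simp: j_def)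
    \<comment> \<open>Absorption: (j+1) C(m,j+1) = (m-j) C(m,j), and m - j = k + 1 is the same for
      all terms.\<close>
    have "(of_int m gchoose Suc j) * of_nat (Suc j) = (of_int (k + 1) :: complex) * (of_int m gchoose j)"
      using gbinomial_mult_1[of "of_int m :: complex" j] by (simp add: j(3) algebra_simps)
    then have "fps_const (of_int m gchoose Suc j) * of_nat (Suc j) =
        (of_int (k + 1) :: complex fps) * fps_const (of_int m gchoose j)"
      by (simp only: fps_of_nat[symmetric] fps_of_int[symmetric] fps_const_mult)
    then show "fps_const (?g m) * (of_nat (nat (m - k)) * fps_nth_deriv (nat (m - k) - 1) (c m)) =
      of_int (k + 1) *
       (fps_const (of_int m gchoose nat (m - (k + 1))) * fps_nth_deriv (nat (m - (k + 1))) (c m))"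
      unfolding j(1,2) by (simp only: mult.assoc[symmetric] diff_Suc_1)
  qed simp
  finally have "rconv 1 h (\<lambda>m. c m * fps_X) k = rconv 1 h c k * fps_X + of_int (k + 1) * rconv 1 h c (k + 1)"
    by (simp only: rconv_def sum_distrib_left power_one mult_1_left)
  then show "pdo_coeff (pdo_right_sum (\<lambda>m. c m * fps_X)) k =
      pdo_coeff (pdo_right_sum c * pdo_monom fps_X 0) k"
    using h by (simp add: pdo_coeff_mult_X pdo_coeff_right_sum[of h])
qed

text \<open>The kernel of \<open>pdo_rho\<close> is the left ideal \<open>\<E>x\<close>.\<close>

lemma pdo_rho_eq_0_iff: "pdo_rho Q = 0 \<longleftrightarrow> (\<exists>R. Q = R * pdo_monom fps_X 0)"
proof
  assume "pdo_rho Q = 0"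
  then have "fls_nth (pdo_rho Q) (- m) = 0" for m by simp
  then have 0: "fps_nth (pdo_right_coeff Q m) 0 = 0" for m by simp
  \<comment> \<open>A power series vanishing at 0 is divisible by x; the quotients are the right
    coefficients of the cofactor \<open>R\<close>.\<close>
  define c where "c m = fps_shift 1 (pdo_right_coeff Q m)" for m
  have "pdo_right_coeff Q m = c m * fps_X" for m
    using 0[of m] by (auto simp: c_def fps_eq_iff)
  then have b: "pdo_right_coeff Q = (\<lambda>m. c m * fps_X)" by blast
  have "bounded_order c"
    using bounded_order_pdo_right_coeff[of Q] by (fastforce simp: bounded_order_def c_def)
  from pdo_right_sum_mult_X[OF this] have "Q = pdo_right_sum c * pdo_monom fps_X 0"
    using pdo_right_sum_right_coeff[of Q] b by simp
  then show "\<exists>R. Q = R * pdo_monom fps_X 0" by blast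
next
  assume "\<exists>R. Q = R * pdo_monom fps_X 0"
  then obtain R where R: "Q = R * pdo_monom fps_X 0" by blast
  let ?b = "pdo_right_coeff R"
  have "bounded_order (\<lambda>m. ?b m * fps_X)"
    using bounded_order_pdo_right_coeff[of R] by (auto simp: bounded_order_def)
  moreover have "Q = pdo_right_sum (\<lambda>m. ?b m * fps_X)"
    by (simp add: pdo_right_sum_mult_X bounded_order_pdo_right_coeff pdo_right_sum_right_coeff R)
  ultimately have "pdo_right_coeff Q = (\<lambda>m. ?b m * fps_X)"
    by (rule pdo_right_coeff_eqI)
  then show "pdo_rho Q = 0" by (simp add: fls_eq_iff)
qed

text \<open>The kernel of \<open>pdo_rho\<close> is a left ideal, so left multiplication descends to
  the quotient.\<close>

lemma pdo_rho_mult_cong: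
  assumes "pdo_rho Q = pdo_rho Q'"
  shows "pdo_rho (P * Q) = pdo_rho (P * Q')"
proof -
  have "pdo_rho (Q - Q') = 0"
    using assms pdo_rho_add[of "Q - Q'" Q'] by simp
  then obtain R where "Q - Q' = R * pdo_monom fps_X 0"
    by (auto simp: pdo_rho_eq_0_iff)
  then have "pdo_rho (P * (Q - Q')) = 0"
    unfolding pdo_rho_eq_0_iff by (metis mult.assoc)
  then show ?thesis
    using pdo_rho_add[of "P * (Q - Q')" "P * Q'"] by (simp add: algebra_simps)
qed

lemma fls_X_inv_mult_X: "fls_X_inv * fls_X = (1 :: complex fls)"
  by (rule fls_eqI) (simp add: fls_X_times_conv_shift)

text \<open>The factors z^-1 and z between the two actions cancel, and an operator is congruent to
  the constant-coefficient operator of its image under \<open>pdo_rho\<close>, modulo the left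
  ideal.\<close>

lemma pdo_act_mult: "pdo_act (P * Q) f = pdo_act P (pdo_act Q f)"
  unfolding pdo_act_def
  by (simp add: mult.assoc fls_X_inv_mult_X pdo_rho_mult_cong[OF pdo_rho_fls_to_pdo])

lemma pdo_act_one [simp]: "pdo_act 1 f = f"
  by (simp add: pdo_act_def pdo_rho_fls_to_pdo mult.assoc fls_X_inv_mult_X mult.commute[of fls_X])

lemma pdo_act_add_left: "pdo_act (P + Q) f = pdo_act P f + pdo_act Q f"
  by (simp add: pdo_act_def distrib_right pdo_rho_add)

lemma pdo_act_add_right: "pdo_act P (f + g) = pdo_act P f + pdo_act P g"
proof -
  have "fls_to_pdo (f + g) = fls_to_pdo f + fls_to_pdo g" for f g
    by (rule pdo_eqI) (simp flip: fps_const_add)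
  then show ?thesis
    by (simp add: pdo_act_def distrib_right distrib_left pdo_rho_add)
qed

lemma pdo_act_zero_left [simp]: "pdo_act 0 f = 0"
  using pdo_act_add_left[of 0 0 f] by simp

lemma pdo_act_zero_right [simp]: "pdo_act P 0 = 0"
  using pdo_act_add_right[of P 0 0] by simp

lemma pdo_act_sum_left: "pdo_act (sum P A) f = (\<Sum>i\<in>A. pdo_act (P i) f)"
  by (induction A rule: infinite_finite_induct) (simp_all add: pdo_act_add_left)

lemma pdo_act_sum_right: "pdo_act P (sum f A) = (\<Sum>i\<in>A. pdo_act P (f i))"
  by (induction A rule: infinite_finite_induct) (simp_all add: pdo_act_add_right)

text \<open>The matrix entries of the action: \<open>P \<cdot> z\<^sup>k = \<Sum>\<^sub>q pdo_kernel P q k z\<^sup>q\<close>, since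
  \<open>x \<cdot> z\<^sup>k = (k + 1) z\<^bsup>k+1\<^esup>\<close> and \<open>\<partial> \<cdot> z\<^sup>k = z\<^bsup>k-1\<^esup>\<close>.\<close>

definition pdo_kernel :: "pdo \<Rightarrow> int \<Rightarrow> int \<Rightarrow> complex" where
  "pdo_kernel P q k = (\<Sum>j | pdo_coeff P (int j + k - q) \<noteq> 0.
     fact j * (of_int q gchoose j) * fps_nth (pdo_coeff P (int j + k - q)) j)"

lemma pdo_kernel_eq:
  assumes "order_le P h" "h + q - k \<le> int n"
  shows "pdo_kernel P q k =
    (\<Sum>j\<le>n. fact j * (of_int q gchoose j) * fps_nth (pdo_coeff P (int j + k - q)) j)"
  unfolding pdo_kernel_def
proof (rule sum.mono_neutral_left)
  show "{j. pdo_coeff P (int j + k - q) \<noteq> 0} \<subseteq> {..n}"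
  proof
    fix j assume "j \<in> {j. pdo_coeff P (int j + k - q) \<noteq> 0}"
    then have "\<not> int j + k - q > h" using order_leD[OF assms(1)] by blast
    then show "j \<in> {..n}" using assms(2) by simp
  qed
qed auto

text \<open>Derivatives of constants vanish, so the product is a plain convolution. The condition on
  \<open>hi\<close> makes the range reach all orders of \<open>P\<close>.\<close>

lemma pdo_coeff_mult_const:
  assumes P: "order_le P h" and f: "\<And>k. k < lo \<Longrightarrow> fls_nth f k = 0" and hi: "h - s \<le> hi"
  shows "pdo_coeff (P * fls_to_pdo f) s =
    (\<Sum>k\<in>{lo..hi}. pdo_coeff P (k + s) * fps_const (fls_nth f k))"
proof -
  define p where "p = hi + s"
  let ?t = "\<lambda>l. pdo_coeff P l * fps_const (fls_nth f (l - s))"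
  have "pdo_coeff (P * fls_to_pdo f) s = (\<Sum>l\<in>{s+lo..p}. \<Sum>m\<in>{s-p..-lo}.
      fps_const (pc l (l + m - s)) * pdo_coeff P l *
      fps_nth_deriv (nat (l + m - s)) (pdo_coeff (fls_to_pdo f) m))"
    unfolding times_pdo.rep_eq
    by (rule pdo_prod_coeff_box) (use P f hi in \<open>auto simp: p_def order_le_def\<close>)
  also have "\<dots> = (\<Sum>l\<in>{s+lo..p}. \<Sum>m\<in>{s-p..-lo}. if m = s - l then ?t l else 0)"
    by (intro sum.cong) (auto simp: pc_def)
  also have "\<dots> = (\<Sum>l\<in>{s+lo..p}. ?t l)"
    by (intro sum.cong) auto
  also have "\<dots> = (\<Sum>k\<in>{lo..hi}. pdo_coeff P (k + s) * fps_const (fls_nth f k))"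
    by (intro sum.reindex_bij_witness[of _ "\<lambda>k. k + s" "\<lambda>l. l - s"]) (auto simp: p_def)
  finally show ?thesis .
qed

text \<open>An operator of order at most \<open>h\<close> sends z^k to a series with exponents at
  least k - h, so only k \<le> q + h matters for the coefficient of z^q.\<close>

lemma pdo_act_nth:
  assumes P: "order_le P h" and f: "\<And>k. k < lo \<Longrightarrow> fls_nth f k = 0" and hi: "q + h \<le> hi"
  shows "fls_nth (pdo_act P f) q = (\<Sum>k\<in>{lo..hi}. pdo_kernel P q k * fls_nth f k)"
proof -
  let ?R = "P * fls_to_pdo (f * fls_X)"
  have fX: "fls_nth (f * fls_X) k = fls_nth f (k - 1)" for k
    by (simp add: fls_X_times_conv_shift)
  have coeff: "pdo_coeff ?R s = (\<Sum>k\<in>{lo..hi}. pdo_coeff P (k + 1 + s) * fps_const (fls_nth f k))"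
    if "h - s \<le> hi + 1" for s
  proof -
    have "pdo_coeff ?R s = (\<Sum>k\<in>{lo+1..hi+1}. pdo_coeff P (k + s) * fps_const (fls_nth f (k - 1)))"
      using that f by (subst pdo_coeff_mult_const[OF P, of "lo + 1" _ _ "hi + 1"]) (auto simp: fX)
    also have "\<dots> = (\<Sum>k\<in>{lo..hi}. pdo_coeff P (k + 1 + s) * fps_const (fls_nth f k))"
      by (intro sum.reindex_bij_witness[of _ "\<lambda>k. k + 1" "\<lambda>k. k - 1"]) auto
    finally show ?thesis .
  qed
  have "order_le (fls_to_pdo (f * fls_X)) (- lo - 1)"
    using f by (auto simp: order_le_def fX)
  from order_le_mult[OF P this] have R: "order_le ?R (h - lo - 1)"
    by (simp add: algebra_simps)
  \<comment> \<open>Large enough both for \<open>?R\<close> at index \<open>q + 1\<close> and for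
    every kernel entry with k \<ge> \<open>lo\<close>.\<close>
  define n where "n = nat (h + q - lo)"
  have "fls_nth (pdo_act P f) q = fls_nth (pdo_rho ?R) (q + 1)"
    by (simp add: pdo_act_def fls_X_inv_times_conv_shift del: fls_nth_pdo_rho)
  \<comment> \<open>The index \<open>q + 1\<close> comes from the factor z^-1 in the action; it
    makes the upper entry of the binomial coefficient equal to \<open>q\<close>.\<close>
  also have "\<dots> = (\<Sum>j\<le>n. fact j * (of_int q gchoose j) * fps_nth (pdo_coeff ?R (int j - (q + 1))) j)"
    by (subst pdo_rho_nth[OF R, of _ n]) (auto simp: n_def)
  also have "\<dots> = (\<Sum>j\<le>n. \<Sum>k\<in>{lo..hi}. fact j * (of_int q gchoose j) *
      fps_nth (pdo_coeff P (int j + k - q)) j * fls_nth f k)"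
    using hi by (intro sum.cong refl, subst coeff)
      (auto simp: fps_sum_nth sum_distrib_left algebra_simps)
  also have "\<dots> = (\<Sum>k\<in>{lo..hi}. \<Sum>j\<le>n. fact j * (of_int q gchoose j) *
      fps_nth (pdo_coeff P (int j + k - q)) j * fls_nth f k)"
    by (rule sum.swap)
  also have "\<dots> = (\<Sum>k\<in>{lo..hi}. pdo_kernel P q k * fls_nth f k)"
    by (intro sum.cong refl) (auto simp: pdo_kernel_eq[OF P, of _ _ n] n_def sum_distrib_right)
  finally show ?thesis .
qed

lemma pdo_act_const_mult: "pdo_act P (fls_const c * f) = fls_const c * pdo_act P f"
proof (rule fls_eqI)
  fix q
  obtain h where h: "order_le P h" using order_le_exists by blast
  have f: "\<And>k. k < fls_subdegree f \<Longrightarrow> fls_nth f k = 0" by simp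
  then have cf: "\<And>k. k < fls_subdegree f \<Longrightarrow> fls_nth (fls_const c * f) k = 0" by simp
  show "fls_nth (pdo_act P (fls_const c * f)) q = fls_nth (fls_const c * pdo_act P f) q"
    using pdo_act_nth[OF h f order_refl] pdo_act_nth[OF h cf order_refl]
    by (simp add: sum_distrib_left mult.left_commute)
qed

section \<open>Adjoints and the residue pairing\<close>

text \<open>Both sides are the derivative of order i + j of \<open>b\<close> at 0.\<close>

lemma fps_nth_nth_deriv:
  "fact j * fps_nth (fps_nth_deriv i b) j = fact (j + i) * fps_nth b (j + i)" for b :: "complex fps"
  using fps_deriv_maclauren_0[of j "fps_nth_deriv i b"] fps_deriv_maclauren_0[of "j + i" b]
  by (simp add: fps_nth_deriv_add_index)

text \<open>Here x^J z^k = J! C(k+J,J) z^(k+J), and \<partial>^m lowers the exponent by m; reaching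
  z^q forces m = J + k - q. The proof passes through left coefficients.\<close>

lemma pdo_kernel_right_sum:
  assumes b: "\<And>m. m > h \<Longrightarrow> b m = 0" and n: "h + q - k \<le> int n"
  shows "pdo_kernel (pdo_right_sum b) q k =
    (\<Sum>J\<le>n. fact J * (of_int (k + int J) gchoose J) * fps_nth (b (int J + k - q)) J)"
proof -
  \<comment> \<open>\<open>i\<close> counts the derivatives produced by moving \<open>b m\<close> to
    the left, \<open>j\<close> is the Taylor index in the kernel entry; \<open>b\<close> enters only
    through i + j.\<close>
  define g :: "nat \<Rightarrow> nat \<Rightarrow> complex" where
    "g i j = (of_int (int (i + j) + k - q) gchoose i) * (of_int q gchoose j) *
      (fact (i + j) * fps_nth (b (int (i + j) + k - q)) (i + j))" for i j
  have "order_le (pdo_right_sum b) h"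
    by (simp add: order_le_def pdo_coeff_right_sum[OF b] rconv_def)
  then have "pdo_kernel (pdo_right_sum b) q k = (\<Sum>j\<le>n. fact j * (of_int q gchoose j) *
      fps_nth (pdo_coeff (pdo_right_sum b) (int j + k - q)) j)"
    using n by (rule pdo_kernel_eq)
  also have "\<dots> = (\<Sum>j\<le>n. \<Sum>i\<le>n - j. g i j)"
  proof (rule sum.cong)
    fix j assume "j \<in> {..n}"
    define s where "s = int j + k - q"
    let ?t = "\<lambda>m. (of_int m gchoose nat (m - s)) * fps_nth (fps_nth_deriv (nat (m - s)) (b m)) j"
    have "fps_nth (pdo_coeff (pdo_right_sum b) s) j = (\<Sum>m\<in>{s..h}. ?t m)"
      by (simp add: pdo_coeff_right_sum[OF b] rconv_def fps_sum_nth)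
    also have "\<dots> = (\<Sum>m\<in>{s..int n + k - q}. ?t m)"
      using n b by (intro sum.mono_neutral_left) auto
    also have "\<dots> = (\<Sum>i\<le>n - j. ?t (s + int i))"
      using \<open>j \<in> {..n}\<close>
      by (intro sum.reindex_bij_witness[of _ "\<lambda>i. s + int i" "\<lambda>m. nat (m - s)"]) (auto simp: s_def)
    finally have "fact j * (of_int q gchoose j) * fps_nth (pdo_coeff (pdo_right_sum b) s) j =
        (\<Sum>i\<le>n - j. (of_int (s + int i) gchoose i) * (of_int q gchoose j) *
          (fact j * fps_nth (fps_nth_deriv i (b (s + int i))) j))"
      by (simp add: sum_distrib_left mult_ac)
    also have "\<dots> = (\<Sum>i\<le>n - j. g i j)"
      unfolding fps_nth_nth_deriv by (simp add: g_def s_def add_ac add_diff_eq)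
    finally show "fact j * (of_int q gchoose j) *
      fps_nth (pdo_coeff (pdo_right_sum b) (int j + k - q)) j = (\<Sum>i\<le>n - j. g i j)"
      by (simp add: s_def)
  qed simp
  also have "\<dots> = (\<Sum>(j, i)\<in>{(j, i). j + i \<le> n}. g i j)"
    by (subst sum.Sigma) (auto intro!: sum.cong)
  also have "\<dots> = (\<Sum>J\<le>n. \<Sum>j\<le>J. g (J - j) j)"
    by (rule sum.triangle_reindex_eq)
  also have "\<dots> = (\<Sum>J\<le>n. fact J * (of_int (k + int J) gchoose J) * fps_nth (b (int J + k - q)) J)"
  proof (rule sum.cong)
    fix J
    \<comment> \<open>Vandermonde for fixed J = i + j: the upper entries q and J + k - q add up to k
      + J.\<close>
    have "(\<Sum>j\<le>J. g (J - j) j) = (\<Sum>j\<in>{0..J}. (of_int q gchoose j) * (of_int (int J + k - q) gchoose (J - j))) *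
        (fact J * fps_nth (b (int J + k - q)) J)"
      unfolding sum_distrib_right atLeast0AtMost by (intro sum.cong) (auto simp: g_def mult_ac)
    then show "(\<Sum>j\<le>J. g (J - j) j) =
        fact J * (of_int (k + int J) gchoose J) * fps_nth (b (int J + k - q)) J"
      unfolding gbinomial_Vandermonde by (simp add: add_ac)
  qed simp
  finally show ?thesis .
qed

lemma pdo_coeff_adjoint:
  assumes "order_le P h"
  shows "pdo_coeff (pdo_adjoint P) k = rconv 1 h (\<lambda>l. fps_compose (pdo_coeff P l) (- fps_X)) k"
  unfolding pdo_adjoint_def by (rule pdo_coeff_right_sum) (simp add: order_leD[OF assms])

lemma order_le_adjoint: "order_le P h \<Longrightarrow> order_le (pdo_adjoint P) h"
  by (simp add: order_le_def[of "pdo_adjoint P"] pdo_coeff_adjoint rconv_def)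

lemma pdo_adjoint_add: "pdo_adjoint (P + Q) = pdo_adjoint P + pdo_adjoint Q"
proof (rule pdo_eqI)
  fix k
  obtain h where h: "order_le P h" "order_le Q h"
    by (metis pdo_common_bound order_le_def)
  show "pdo_coeff (pdo_adjoint (P + Q)) k = pdo_coeff (pdo_adjoint P + pdo_adjoint Q) k"
    by (simp add: pdo_coeff_adjoint[OF h(1)] pdo_coeff_adjoint[OF h(2)]
      pdo_coeff_adjoint[OF order_le_add[OF h]] rconv_def fps_compose_add_distrib
      algebra_simps sum.distrib)
qed

lemma pdo_adjoint_0 [simp]: "pdo_adjoint 0 = 0"
  using pdo_adjoint_add[of 0 0] by simp

lemma pdo_adjoint_1 [simp]: "pdo_adjoint 1 = 1"
proof (rule pdo_eqI)
  fix k
  have "pdo_coeff (pdo_adjoint 1) k = (\<Sum>m\<in>{k..0}. if m = 0 then (if k = 0 then 1 else 0) else 0)"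
    unfolding pdo_coeff_adjoint[OF order_le_one] rconv_def
    by (intro sum.cong) (auto simp: one_pdo.rep_eq)
  then show "pdo_coeff (pdo_adjoint 1) k = pdo_coeff 1 k"
    by (auto simp: one_pdo.rep_eq)
qed

text \<open>On basis vectors the residue pairing is \<open>\<langle>z\<^sup>k, z\<^sup>q\<rangle> = (if k + q = -1 then 1 else 0)\<close>, so transposing
  with respect to it reflects both indices at \<open>-1/2\<close>.\<close>

lemma pdo_kernel_adjoint: "pdo_kernel (pdo_adjoint P) q k = pdo_kernel P (-1 - k) (-1 - q)"
proof -
  obtain h where h: "order_le P h" using order_le_exists by blast
  define n where "n = nat (h + q - k)"
  have "pdo_kernel (pdo_adjoint P) q k = (\<Sum>J\<le>n. fact J * (of_int (k + int J) gchoose J) *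
      fps_nth (fps_compose (pdo_coeff P (int J + k - q)) (- fps_X)) J)"
    unfolding pdo_adjoint_def
    by (rule pdo_kernel_right_sum[of h]) (auto simp: n_def order_leD[OF h])
  \<comment> \<open>Substituting -x for x contributes (-1)^J, and (-1)^J C(k+J,J) =
    C(-1-k,J).\<close>
  also have "\<dots> = (\<Sum>J\<le>n. fact J * (of_int (-1 - k) gchoose J) *
      fps_nth (pdo_coeff P (int J + (-1 - q) - (-1 - k))) J)"
    by (intro sum.cong)
      (auto simp: fps_compose_uminus' gbinomial_negated_upper[of "- 1 - of_int k"] algebra_simps)
  also have "\<dots> = pdo_kernel P (-1 - k) (-1 - q)"
    by (rule pdo_kernel_eq[OF h, symmetric]) (auto simp: n_def)
  finally show ?thesis .
qed

lemma fls_residue_mult: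
  fixes f g :: "'a::{comm_monoid_add,mult_zero} fls"
  assumes "\<And>k. k < lo \<Longrightarrow> fls_nth f k = 0" "\<And>k. k > hi \<Longrightarrow> fls_nth g (-1 - k) = 0"
  shows "fls_nth (f * g) (-1) = (\<Sum>k\<in>{lo..hi}. fls_nth f k * fls_nth g (-1 - k))"
  unfolding fls_times_nth(2)[of f g]
  by (rule sum.mono_neutral_cong) (use assms in \<open>auto simp: not_le\<close>)

text \<open>Both sides are the same finite double sum of f_k K(q,k) g_(-1-q), where K is
  \<open>pdo_kernel P\<close>; the reflection of indices in the kernel of the adjoint matches the
  pairing.\<close>

lemma residue_pdo_act:
  "fls_nth (pdo_act P f * g) (-1) = fls_nth (f * pdo_act (pdo_adjoint P) g) (-1)"
proof -
  obtain h where P: "order_le P h" using order_le_exists by blast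
  note P' = order_le_adjoint[OF P]
  define a where "a = fls_subdegree f"
  \<comment> \<open>The largest q for which g_(-1-q) can be nonzero. All sums then fit into the box
    with q in [a-h, b] and k in [a, b+h].\<close>
  define b where "b = - 1 - fls_subdegree g"
  have f: "fls_nth f k = 0" if "k < a" for k using that by (simp add: a_def)
  have g: "fls_nth g k = 0" if "k < -1 - b" for k using that by (simp add: b_def)
  have Pf: "fls_nth (pdo_act P f) q = (\<Sum>k\<in>{a..b+h}. pdo_kernel P q k * fls_nth f k)"
    if "q \<le> b" for q
    by (rule pdo_act_nth[OF P f]) (use that in auto)
  have Pg: "fls_nth (pdo_act (pdo_adjoint P) g) (-1 - k) =
      (\<Sum>q\<in>{a-h..b}. pdo_kernel P q k * fls_nth g (-1 - q))" if "a \<le> k" for k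
  proof -
    have "fls_nth (pdo_act (pdo_adjoint P) g) (-1 - k) =
      (\<Sum>r\<in>{-1-b..-1-(a-h)}. pdo_kernel (pdo_adjoint P) (-1 - k) r * fls_nth g r)"
      by (rule pdo_act_nth[OF P' g]) (use that in auto)
    also have "\<dots> = (\<Sum>q\<in>{a-h..b}. pdo_kernel P q k * fls_nth g (-1 - q))"
      by (intro sum.reindex_bij_witness[of _ "\<lambda>q. -1 - q" "\<lambda>q. -1 - q"]) (auto simp: pdo_kernel_adjoint)
    finally show ?thesis .
  qed
  \<comment> \<open>Outside the box the sum from \<open>pdo_act_nth\<close> has an empty
    range.\<close>
  have Pf0: "fls_nth (pdo_act P f) q = 0" if "q < a - h" for q
    using pdo_act_nth[of P h a f q "q + h"] P f that by simp
  have Pg0: "fls_nth (pdo_act (pdo_adjoint P) g) (-1 - k) = 0" if "k > b + h" for k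
    using pdo_act_nth[of _ h "-1 - b" g "-1 - k" "-1 - k + h"] P' g that by simp
  have "fls_nth (pdo_act P f * g) (-1) =
      (\<Sum>q\<in>{a-h..b}. fls_nth (pdo_act P f) q * fls_nth g (-1 - q))"
    by (rule fls_residue_mult[OF Pf0]) (auto intro: g)
  also have "\<dots> = (\<Sum>q\<in>{a-h..b}. \<Sum>k\<in>{a..b+h}. fls_nth f k * (pdo_kernel P q k * fls_nth g (-1 - q)))"
    by (intro sum.cong) (auto simp: Pf sum_distrib_left sum_distrib_right mult_ac)
  also have "\<dots> = (\<Sum>k\<in>{a..b+h}. \<Sum>q\<in>{a-h..b}. fls_nth f k * (pdo_kernel P q k * fls_nth g (-1 - q)))"
    by (rule sum.swap)
  also have "\<dots> = (\<Sum>k\<in>{a..b+h}. fls_nth f k * fls_nth (pdo_act (pdo_adjoint P) g) (-1 - k))"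
    by (intro sum.cong) (auto simp: Pg sum_distrib_left)
  also have "\<dots> = fls_nth (f * pdo_act (pdo_adjoint P) g) (-1)"
    by (rule fls_residue_mult[symmetric]) (auto intro: f Pg0)
  finally show ?thesis .
qed

text \<open>The matrix transpose amounts to interchanging the two sums over components.\<close>

lemma residue_pairing_adjoint:
  "residue_pairing (pdo_mat_act P f) g = residue_pairing f (pdo_mat_act (pdo_mat_adjoint P) g)"
proof -
  have "residue_pairing (pdo_mat_act P f) g =
      (\<Sum>i\<in>UNIV. \<Sum>j\<in>UNIV. fls_nth (pdo_act (P $ i $ j) (f $ j) * g $ i) (-1))"
    by (simp add: residue_pairing_def pdo_mat_act_def sum_distrib_right fls_nth_sum)
  also have "\<dots> = (\<Sum>j\<in>UNIV. \<Sum>i\<in>UNIV. fls_nth (f $ j * pdo_act (pdo_adjoint (P $ i $ j)) (g $ i)) (-1))"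
    unfolding residue_pdo_act by (rule sum.swap)
  also have "\<dots> = residue_pairing f (pdo_mat_act (pdo_mat_adjoint P) g)"
    by (simp add: residue_pairing_def pdo_mat_act_def pdo_mat_adjoint_def sum_distrib_left fls_nth_sum)
  finally show ?thesis .
qed

lemma residue_pairing_commute: "residue_pairing f g = residue_pairing g f"
  by (simp add: residue_pairing_def mult.commute)

section \<open>The action of matrices of operators\<close>

lemma pdo_mat_act_mult: "pdo_mat_act (A ** B) f = pdo_mat_act A (pdo_mat_act B f)"
proof -
  have "pdo_mat_act (A ** B) f $ i = pdo_mat_act A (pdo_mat_act B f) $ i" for i
    by (simp add: pdo_mat_act_def matrix_matrix_mult_def pdo_act_sum_left pdo_act_sum_right
      pdo_act_mult) (rule sum.swap)
  then show ?thesis by (simp add: vec_eq_iff)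
qed

lemma pdo_mat_act_mat_1 [simp]: "pdo_mat_act (mat 1) f = f"
  by (simp add: pdo_mat_act_def mat_def vec_eq_iff if_distrib[of "\<lambda>x. pdo_act x _"] cong: if_cong)

lemma pdo_mat_act_add: "pdo_mat_act A (f + g) = pdo_mat_act A f + pdo_mat_act A g"
  by (simp add: pdo_mat_act_def vec_eq_iff pdo_act_add_right sum.distrib)

lemma pdo_mat_act_scale: "pdo_mat_act A (laurent_scale c f) = laurent_scale c (pdo_mat_act A f)"
  by (simp add: pdo_mat_act_def laurent_scale_def vec_eq_iff pdo_act_const_mult sum_distrib_left)

section \<open>The group of monic operators of order zero\<close>

definition mat_order_le :: "pdo^'n^'m \<Rightarrow> int \<Rightarrow> bool" where
  "mat_order_le A h \<longleftrightarrow> (\<forall>i j. order_le (A $ i $ j) h)"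

lemma mat_order_le_mono: "mat_order_le A h \<Longrightarrow> h \<le> h' \<Longrightarrow> mat_order_le A h'"
  by (auto simp: mat_order_le_def intro: order_le_mono)

lemma mat_order_le_add: "mat_order_le A h \<Longrightarrow> mat_order_le B h \<Longrightarrow> mat_order_le (A + B) h"
  by (simp add: mat_order_le_def order_le_add)

lemma mat_order_le_diff: "mat_order_le A h \<Longrightarrow> mat_order_le B h \<Longrightarrow> mat_order_le (A - B) h"
  by (simp add: mat_order_le_def order_le_diff)

lemma mat_order_le_uminus: "mat_order_le A h \<Longrightarrow> mat_order_le (- A) h"
  by (simp add: mat_order_le_def order_le_uminus)

lemma mat_order_le_mult: "mat_order_le A p \<Longrightarrow> mat_order_le B q \<Longrightarrow> mat_order_le (A ** B) (p + q)"
  by (simp add: mat_order_le_def matrix_matrix_mult_def order_le_sum order_le_mult)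

lemma mat_order_le_mat_1: "mat_order_le (mat 1) 0"
  by (simp add: mat_order_le_def mat_def order_le_one)

text \<open>The order filtration is separated, which makes limits in it unique.\<close>

lemma mat_order_le_all_imp_0: "(\<And>n. mat_order_le A (-1 - int n)) \<Longrightarrow> A = 0"
proof -
  assume *: "\<And>n. mat_order_le A (-1 - int n)"
  have "pdo_coeff (A $ i $ j) m = 0" for i j m
    using *[of "nat (- m)"] by (simp add: mat_order_le_def order_le_def)
  then show "A = 0" by (auto simp: vec_eq_iff intro: pdo_eqI)
qed

lemma monic_order_0_iff: "S \<in> monic_order_0 \<longleftrightarrow> mat_order_le (S - mat 1) (-1)"
proof
  assume "S \<in> monic_order_0"
  then show "mat_order_le (S - mat 1) (-1)"
    by (auto simp: monic_order_0_def mat_order_le_def order_le_def)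
next
  assume "mat_order_le (S - mat 1) (-1)"
  then have "\<forall>i j. \<forall>m\<ge>0. pdo_coeff ((S - mat 1) $ i $ j) m = 0"
    by (simp add: mat_order_le_def order_le_def)
  moreover have "S = mat 1 + (S - mat 1)" by simp
  ultimately show "S \<in> monic_order_0" unfolding monic_order_0_def by blast
qed

lemma monic_order_0_imp_mat_order_le: "S \<in> monic_order_0 \<Longrightarrow> mat_order_le S 0"
  using mat_order_le_add[OF mat_order_le_mono[of "S - mat 1" "-1" 0] mat_order_le_mat_1]
  by (simp add: monic_order_0_iff)

text \<open>The adjoint is additive, fixes 1 and preserves bounds on the order.\<close>

lemma monic_order_0_adjoint:
  assumes "S \<in> monic_order_0"
  shows "pdo_mat_adjoint S \<in> monic_order_0"
proof -
  let ?T = "S - mat 1"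
  have "pdo_mat_adjoint S = pdo_mat_adjoint ?T + mat 1"
  proof -
    have "pdo_adjoint (S $ j $ i) = pdo_adjoint (?T $ j $ i) + mat 1 $ i $ j" for i j
      using pdo_adjoint_add[of "?T $ j $ i" "mat 1 $ j $ i"] by (simp add: mat_def)
    then show ?thesis by (simp add: pdo_mat_adjoint_def vec_eq_iff)
  qed
  moreover have "mat_order_le (pdo_mat_adjoint ?T) (-1)"
    using assms
    by (simp add: monic_order_0_iff mat_order_le_def pdo_mat_adjoint_def order_le_adjoint)
  ultimately show ?thesis by (simp add: monic_order_0_iff)
qed

section \<open>Neumann series and inverses\<close>

lemma matrix_diff_ldistrib: "A ** (B - C) = A ** B - A ** C" for A :: "'a::ring_1^'n^'m"
  by (simp add: matrix_matrix_mult_def vec_eq_iff right_diff_distrib sum_subtractf)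

lemma matrix_diff_rdistrib: "(A - B) ** C = A ** C - B ** C" for A :: "'a::ring_1^'n^'m"
  by (simp add: matrix_matrix_mult_def vec_eq_iff left_diff_distrib sum_subtractf)

text \<open>Since \<open>U\<close> lowers the order by at least one, Z \<mapsto> 1 + U Z is a
  contraction for the order filtration; its fixed point is the sum of all powers of
  \<open>U\<close>.\<close>

lemma neumann_series_exists:
  fixes U :: "pdo^'n^'n"
  assumes U: "mat_order_le U (-1)"
  obtains Y where "Y = mat 1 + U ** Y" "mat_order_le Y 0"
proof -
  \<comment> \<open>The partial sums 1 + U + ... + U^n, obtained by iteration.\<close>
  define X where "X n = ((\<lambda>Z. mat 1 + U ** Z) ^^ n) (mat 1)" for n
  have X0: "X 0 = mat 1" and XS: "X (Suc n) = mat 1 + U ** X n" for n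
    by (simp_all add: X_def)
  have step: "mat_order_le (X (Suc n) - X n) (-1 - int n)" for n
  proof (induction n)
    case 0
    then show ?case using U by (simp add: XS X0)
  next
    case (Suc n)
    have "X (Suc (Suc n)) - X (Suc n) = U ** (X (Suc n) - X n)"
      by (simp add: XS[of "Suc n"] XS[of n] matrix_diff_ldistrib)
    then show ?case
      using mat_order_le_mono[OF mat_order_le_mult[OF U Suc.IH]] by simp
  qed
  have stable: "mat_order_le (X (n + m) - X n) (-1 - int n)" for n m
  proof (induction m)
    case 0
    then show ?case by (simp add: mat_order_le_def)
  next
    case (Suc m)
    have "mat_order_le (X (Suc (n + m)) - X (n + m)) (-1 - int n)"
      by (rule mat_order_le_mono[OF step]) simp
    from mat_order_le_add[OF this Suc.IH] show ?case by simp
  qed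
  \<comment> \<open>The coefficient of \<partial>^k is already final at stage
    \<open>nat (- k)\<close>: later corrections have order at most -1 - \<open>nat (- k)\<close>,
    which is below k.\<close>
  define Y :: "pdo^'n^'n" where
    "Y = (\<chi> i j. Abs_pdo (\<lambda>k. pdo_coeff (X (nat (- k)) $ i $ j) k))"
  have Y: "pdo_coeff (Y $ i $ j) k = pdo_coeff (X (nat (- k)) $ i $ j) k" for i j k
  proof -
    have "bounded_order (\<lambda>k. pdo_coeff (X (nat (- k)) $ i $ j) k)"
      unfolding bounded_order_def
      by (intro exI[of _ 0]) (auto simp: X0 mat_def one_pdo.rep_eq)
    then show ?thesis by (simp add: Y_def Abs_pdo_inverse)
  qed
  have YX: "mat_order_le (Y - X n) (-1 - int n)" for n
    unfolding mat_order_le_def order_le_def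
  proof (intro allI impI)
    fix i j k assume k: "- 1 - int n < k"
    then have "n = nat (- k) + (n - nat (- k))" by simp
    then have "mat_order_le (X n - X (nat (- k))) (-1 - int (nat (- k)))"
      using stable by metis
    then have "pdo_coeff ((X n - X (nat (- k))) $ i $ j) k = 0"
      unfolding mat_order_le_def order_le_def by simp
    then show "pdo_coeff ((Y - X n) $ i $ j) k = 0"
      by (simp add: Y pdo_coeff_diff)
  qed
  have "Y - (mat 1 + U ** Y) = 0"
  proof (rule mat_order_le_all_imp_0)
    fix n
    \<comment> \<open>Replacing \<open>Y\<close> by its approximations bounds the defect by
      arbitrarily low orders.\<close>
    have "Y - (mat 1 + U ** Y) = (Y - X (Suc n)) - U ** (Y - X n)"
      by (simp add: XS matrix_diff_ldistrib)
    moreover have "mat_order_le (Y - X (Suc n)) (-1 - int n)"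
      by (rule mat_order_le_mono[OF YX]) simp
    moreover have "mat_order_le (U ** (Y - X n)) (-1 - int n)"
      by (rule mat_order_le_mono[OF mat_order_le_mult[OF U YX]]) simp
    ultimately show "mat_order_le (Y - (mat 1 + U ** Y)) (-1 - int n)"
      by (simp only: mat_order_le_diff)
  qed
  moreover have "mat_order_le Y 0"
    using mat_order_le_add[OF mat_order_le_mono[OF YX[of 0], of 0] mat_order_le_mat_1] by (simp add: X0)
  ultimately show ?thesis using that by simp
qed

lemma monic_order_0_right_inverse:
  assumes S: "S \<in> monic_order_0"
  obtains Y where "Y \<in> monic_order_0" "S ** Y = mat 1"
proof -
  define U where "U = mat 1 - S"
  have U: "mat_order_le U (-1)"
    using mat_order_le_uminus[of "S - mat 1"] S by (simp add: U_def monic_order_0_iff)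
  then obtain Y where Y: "Y = mat 1 + U ** Y" "mat_order_le Y 0"
    by (rule neumann_series_exists)
  have YU: "Y - mat 1 = U ** Y" using Y(1) by (metis add_diff_cancel_left')
  then have "Y \<in> monic_order_0"
    using mat_order_le_mult[OF U Y(2)] by (simp add: monic_order_0_iff)
  moreover have "S ** Y = mat 1"
  proof -
    have "S ** Y = (mat 1 - U) ** Y" by (simp add: U_def)
    also have "\<dots> = Y - U ** Y" by (simp add: matrix_diff_rdistrib)
    also have "\<dots> = mat 1" by (simp flip: YU)
    finally show ?thesis .
  qed
  ultimately show ?thesis by (rule that)
qed

text \<open>\<open>matrix_inv\<close> is a choice among two-sided inverses, and a two-sided inverse
  is unique, also over noncommutative entries.\<close>

lemma matrix_inv_eqI:
  fixes A :: "'a::semiring_1^'n^'n"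
  assumes "A ** B = mat 1" "B ** A = mat 1"
  shows "matrix_inv A = B"
proof -
  have "A ** matrix_inv A = mat 1 \<and> matrix_inv A ** A = mat 1"
    unfolding matrix_inv_def by (rule someI[of _ B]) (use assms in simp)
  then show ?thesis
    by (metis assms(1) matrix_mul_assoc matrix_mul_lid matrix_mul_rid)
qed

text \<open>The right inverse \<open>Y\<close> is itself monic, so it has a right inverse
  \<open>Z\<close>. Then Z = (S Y) Z = S (Y Z) = S, which makes \<open>Y\<close> two-sided.\<close>

lemma monic_order_0_inverse:
  assumes S: "S \<in> monic_order_0"
  shows "invertible S" "matrix_inv S \<in> monic_order_0"
    "S ** matrix_inv S = mat 1" "matrix_inv S ** S = mat 1"
proof -
  obtain Y where Y: "Y \<in> monic_order_0" "S ** Y = mat 1"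
    using monic_order_0_right_inverse[OF S] .
  obtain Z where Z: "Y ** Z = mat 1"
    using monic_order_0_right_inverse[OF Y(1)] .
  have "Z = S" by (metis Y(2) Z matrix_mul_assoc matrix_mul_lid matrix_mul_rid)
  then have "matrix_inv S = Y" "Y ** S = mat 1"
    using Y(2) Z by (auto intro: matrix_inv_eqI)
  then show "invertible S" "matrix_inv S \<in> monic_order_0"
    "S ** matrix_inv S = mat 1" "matrix_inv S ** S = mat 1"
    using Y by (auto simp: invertible_def)
qed

lemma matrix_inv_matrix_inv:
  "S \<in> monic_order_0 \<Longrightarrow> matrix_inv (matrix_inv S) = S"
  by (intro matrix_inv_eqI) (simp_all add: monic_order_0_inverse)

section \<open>Points of the big cell\<close>

lemma nth_poly_part:
  "fls_nth (poly (map_poly fls_const p) fls_X_inv * fls_X_inv) k =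
    (if k < 0 then coeff p (nat (-1 - k)) else 0)" for p :: "complex poly"
proof -
  have X: "fls_nth (fls_X_inv ^ i * fls_X_inv) k = (if k = - int i - 1 then 1 else 0 :: complex)" for i
    unfolding power_Suc2[symmetric] fls_X_inv_power_nth by auto
  have "fls_nth (poly (map_poly fls_const p) fls_X_inv * fls_X_inv) k =
      (\<Sum>i\<le>degree p. coeff p i * (if k = - int i - 1 then 1 else 0))"
    by (simp add: poly_altdef degree_map_poly coeff_map_poly sum_distrib_right fls_nth_sum
      mult.assoc X)
  also have "\<dots> = (\<Sum>i\<le>degree p. if i = nat (- 1 - k) then (if k < 0 then coeff p i else 0) else 0)"
    by (intro sum.cong) auto
  also have "\<dots> = (if k < 0 then coeff p (nat (-1 - k)) else 0)"
    by (auto simp: coeff_eq_0)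
  finally show ?thesis .
qed

text \<open>A Laurent series has finitely many terms of negative exponent, so one without terms of
  nonnegative exponent is a polynomial in z^-1 times z^-1.\<close>

lemma polynomial_part_iff: "f \<in> polynomial_part \<longleftrightarrow> (\<forall>i. \<forall>k\<ge>0. fls_nth (f $ i) k = 0)"
proof
  assume f: "\<forall>i. \<forall>k\<ge>0. fls_nth (f $ i) k = 0"
  have "\<exists>p. f $ i = poly (map_poly fls_const p) fls_X_inv * fls_X_inv" for i
  proof -
    define p where "p = Abs_poly (\<lambda>n. fls_nth (f $ i) (-1 - int n))"
    have "coeff p n = fls_nth (f $ i) (-1 - int n)" for n
      unfolding p_def by (subst coeff_Abs_poly[of "nat (- fls_subdegree (f $ i))"]) auto
    then have "f $ i = poly (map_poly fls_const p) fls_X_inv * fls_X_inv"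
      using f by (intro fls_eqI) (auto simp: nth_poly_part)
    then show ?thesis by blast
  qed
  then show "f \<in> polynomial_part" by (simp add: polynomial_part_def)
next
  assume f: "f \<in> polynomial_part"
  show "\<forall>i. \<forall>k\<ge>0. fls_nth (f $ i) k = 0"
  proof (intro allI impI)
    fix i and k :: int assume "k \<ge> 0"
    obtain p :: "complex poly" where "f $ i = poly (map_poly fls_const p) fls_X_inv * fls_X_inv"
      using f by (auto simp: polynomial_part_def)
    then show "fls_nth (f $ i) k = 0" using \<open>k \<ge> 0\<close> by (simp only: nth_poly_part) simp
  qed
qed

lemma power_series_vectors_iff: "f \<in> power_series_vectors \<longleftrightarrow> (\<forall>i. \<forall>k<0. fls_nth (f $ i) k = 0)"
proof -
  have "g \<in> range fps_to_fls \<longleftrightarrow> (\<forall>k<0. fls_nth g k = 0)" for g :: "complex fls"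
  proof
    assume "\<forall>k<0. fls_nth g k = 0"
    then have "fls_subdegree g \<ge> 0"
      by (cases "g = 0") (auto simp: not_less[symmetric] dest: nth_fls_subdegree_nonzero)
    then show "g \<in> range fps_to_fls" by (metis fls_regpart_to_fls_trivial rangeI)
  qed auto
  then show ?thesis by (simp add: power_series_vectors_def)
qed

lemma mod_power_series_eq_iff:
  "mod_power_series f = mod_power_series g \<longleftrightarrow> f - g \<in> power_series_vectors"
proof
  assume *: "mod_power_series f = mod_power_series g"
  have "f + 0 \<in> mod_power_series f"
    unfolding mod_power_series_def by (auto simp: power_series_vectors_iff intro!: exI[of _ 0])
  then have "f \<in> mod_power_series g" using * by simp
  then show "f - g \<in> power_series_vectors" by (auto simp: mod_power_series_def)
next
  assume fg: "f - g \<in> power_series_vectors"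
  have "mod_power_series a \<subseteq> mod_power_series b" if "a - b \<in> power_series_vectors" for a b :: "complex fls^'n"
  proof
    fix u assume "u \<in> mod_power_series a"
    then obtain c where c: "u = a + c" "c \<in> power_series_vectors" by (auto simp: mod_power_series_def)
    then have "u = b + ((a - b) + c)" "(a - b) + c \<in> power_series_vectors"
      using that by (auto simp: power_series_vectors_iff)
    then show "u \<in> mod_power_series b" unfolding mod_power_series_def by blast
  qed
  moreover have "g - f \<in> power_series_vectors"
    using fg by (auto simp: power_series_vectors_iff)
  ultimately show "mod_power_series f = mod_power_series g" using fg by blast
qed

text \<open>Operators of order at most 0 do not lower exponents: the sum giving a coefficient of
  negative index has an empty range.\<close>

lemma pdo_mat_act_power_series:
  assumes A: "mat_order_le A 0" and f: "f \<in> power_series_vectors"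
  shows "pdo_mat_act A f \<in> power_series_vectors"
proof -
  have "fls_nth (pdo_act (A $ i $ j) (f $ j)) k = 0" if "k < 0" for i j k
  proof -
    have "order_le (A $ i $ j) 0" using A by (simp add: mat_order_le_def)
    moreover have "\<And>l. l < 0 \<Longrightarrow> fls_nth (f $ j) l = 0"
      using f by (simp add: power_series_vectors_iff)
    ultimately show ?thesis
      using that by (subst pdo_act_nth[of _ 0 0 _ _ k]) auto
  qed
  then show ?thesis
    by (simp add: power_series_vectors_iff pdo_mat_act_def fls_nth_sum)
qed

text \<open>Both \<open>S\<close> and its inverse preserve the power series vectors, and
  \<open>polynomial_part\<close> is a complement of these; hence so is its image. Below,
  \<open>disjoint\<close> gives injectivity and \<open>cover\<close> surjectivity of the natural
  map.\<close>

lemma monic_image_in_big_cell: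
  fixes S :: "pdo^'n^'n"
  assumes S: "S \<in> monic_order_0"
  shows "pdo_mat_act S ` polynomial_part \<in> big_cell"
proof -
  define W where "W = pdo_mat_act S ` polynomial_part"
  define T where "T = matrix_inv S"
  have ord: "mat_order_le S 0" "mat_order_le T 0"
    using S by (auto simp: T_def intro: monic_order_0_imp_mat_order_le monic_order_0_inverse)
  have TS: "pdo_mat_act T (pdo_mat_act S f) = f" and ST: "pdo_mat_act S (pdo_mat_act T f) = f" for f
    using S by (simp_all add: T_def monic_order_0_inverse flip: pdo_mat_act_mult)
  have sub: "laurent.subspace W"
  proof (rule laurent.subspaceI)
    have "pdo_mat_act S 0 = 0" by (simp add: pdo_mat_act_def vec_eq_iff)
    then show "0 \<in> W"
      unfolding W_def by (intro image_eqI[of _ _ 0]) (simp_all add: polynomial_part_iff)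
  next
    fix x y assume "x \<in> W" "y \<in> W"
    then obtain f g where "x = pdo_mat_act S f" "y = pdo_mat_act S g"
      "f \<in> polynomial_part" "g \<in> polynomial_part" by (auto simp: W_def)
    then have "x + y = pdo_mat_act S (f + g)" "f + g \<in> polynomial_part"
      by (auto simp: pdo_mat_act_add polynomial_part_iff)
    then show "x + y \<in> W" by (simp add: W_def)
  next
    fix c x assume "x \<in> W"
    then obtain f where "x = pdo_mat_act S f" "f \<in> polynomial_part" by (auto simp: W_def)
    then have "laurent_scale c x = pdo_mat_act S (laurent_scale c f)"
      by (simp add: pdo_mat_act_scale)
    moreover have "laurent_scale c f \<in> polynomial_part"
      using \<open>f \<in> polynomial_part\<close> by (simp add: polynomial_part_iff laurent_scale_def)
    ultimately show "laurent_scale c x \<in> W" by (simp add: W_def)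
  qed
  have disjoint: "w = 0" if "w \<in> W" "w \<in> power_series_vectors" for w
  proof -
    obtain f where f: "w = pdo_mat_act S f" "f \<in> polynomial_part" using \<open>w \<in> W\<close> by (auto simp: W_def)
    have "f \<in> power_series_vectors"
      using pdo_mat_act_power_series[OF ord(2) that(2)] by (simp add: f TS)
    then have "fls_nth (f $ i) k = 0" for i k
      using f(2) by (cases "k < 0") (auto simp: power_series_vectors_iff polynomial_part_iff)
    then have "f = 0" by (simp add: vec_eq_iff fls_eq_iff)
    then show "w = 0" by (simp add: f pdo_mat_act_def vec_eq_iff)
  qed
  have cover: "\<exists>w\<in>W. mod_power_series f = mod_power_series w" for f :: "complex fls^'n"
  proof -
    \<comment> \<open>Pull \<open>f\<close> back by the inverse, split off the regular part
      \<open>v\<close>, and push forward; the image of \<open>v\<close> remains a power series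
      vector.\<close>
    define g where "g = pdo_mat_act T f"
    define v where "v = (\<chi> i. fps_to_fls (fls_regpart (g $ i)))"
    have "g - v \<in> polynomial_part" "v \<in> power_series_vectors"
      by (auto simp: v_def polynomial_part_iff power_series_vectors_iff)
    moreover have "f - pdo_mat_act S (g - v) = pdo_mat_act S v"
    proof -
      have "f = pdo_mat_act S (g - v + v)" by (simp add: g_def ST)
      also have "\<dots> = pdo_mat_act S (g - v) + pdo_mat_act S v" by (rule pdo_mat_act_add)
      finally show ?thesis by simp
    qed
    ultimately have "pdo_mat_act S (g - v) \<in> W"
      "mod_power_series f = mod_power_series (pdo_mat_act S (g - v))"
      using pdo_mat_act_power_series[OF ord(1)] by (auto simp: W_def mod_power_series_eq_iff)
    then show ?thesis by blast
  qed
  have "(0 :: complex fls^'n) \<in> power_series_vectors"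
    by (simp add: power_series_vectors_iff)
  \<comment> \<open>The kernel is zero, the span of the empty set; the same empty set serves for the
    cokernel.\<close>
  then have "{w \<in> W. mod_power_series w = mod_power_series 0} = laurent.span {}"
    using disjoint laurent.subspace_0[OF sub] by (auto simp: mod_power_series_eq_iff)
  then have "fin_dim_kernel W" unfolding fin_dim_kernel_def by blast
  moreover have "fin_dim_cokernel W"
    unfolding fin_dim_cokernel_def using cover by (intro exI[of _ "{}"]) simp
  moreover have "bij_betw mod_power_series W (range mod_power_series)"
    unfolding bij_betw_def
  proof
    show "inj_on mod_power_series W"
    proof (rule inj_onI)
      fix x y assume "x \<in> W" "y \<in> W" "mod_power_series x = mod_power_series y"
      then have "x - y = 0"
        by (intro disjoint laurent.subspace_diff[OF sub]) (simp_all add: mod_power_series_eq_iff)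
      then show "x = y" by simp
    qed
    show "mod_power_series ` W = range mod_power_series"
      using cover by blast
  qed
  ultimately show ?thesis
    using sub by (simp add: big_cell_def Grassmannian_def flip: W_def)
qed

section \<open>Orthogonal complements\<close>

lemma perp_polynomial_part: "perp polynomial_part = (polynomial_part :: (complex fls^'n) set)"
proof
  show "perp polynomial_part \<subseteq> (polynomial_part :: (complex fls^'n) set)"
  proof
    fix f :: "complex fls^'n" assume f: "f \<in> perp polynomial_part"
    have "fls_nth (f $ i) k = 0" if "k \<ge> 0" for i k
    proof -
      obtain n where k: "k = int n" using \<open>k \<ge> 0\<close> nonneg_int_cases by blast
      \<comment> \<open>Pairing with z^(-n-1) in component \<open>i\<close> reads off the
        coefficient of z^n of that component.\<close>
      define w :: "complex fls^'n" where "w = axis i (fls_X_inv ^ Suc n)"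
      have "w \<in> polynomial_part"
        by (auto simp: w_def polynomial_part_iff axis_def simp del: power_Suc)
      then have "residue_pairing f w = 0" using f by (simp add: perp_def)
      moreover have "residue_pairing f w = fls_nth (f $ i * fls_X_inv ^ Suc n) (-1)"
      proof -
        have "residue_pairing f w =
            (\<Sum>j\<in>UNIV. if j = i then fls_nth (f $ i * fls_X_inv ^ Suc n) (-1) else 0)"
          unfolding residue_pairing_def by (intro sum.cong) (auto simp: w_def axis_def)
        then show ?thesis by simp
      qed
      moreover have "fls_nth (f $ i * fls_X_inv ^ Suc n) (-1) = fls_nth (f $ i) k"
        by (simp add: fls_X_inv_power_times_conv_shift k del: power_Suc)
      ultimately show ?thesis by simp
    qed
    then show "f \<in> polynomial_part" by (simp add: polynomial_part_iff)
  qed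
next
  show "(polynomial_part :: (complex fls^'n) set) \<subseteq> perp polynomial_part"
  proof
    fix f :: "complex fls^'n" assume f: "f \<in> polynomial_part"
    have "residue_pairing f w = 0" if w: "w \<in> polynomial_part" for w
      unfolding residue_pairing_def
    proof (intro sum.neutral ballI)
      fix i
      \<comment> \<open>One of k and -1 - k is always nonnegative.\<close>
      have "fls_nth (f $ i) k * fls_nth (w $ i) (-1 - k) = 0" for k
        using f w by (cases "k \<ge> 0") (auto simp: polynomial_part_iff)
      then show "fls_nth (f $ i * w $ i) (-1) = 0"
        by (simp only: fls_times_nth(2) sum.neutral_const)
    qed
    then show "f \<in> perp polynomial_part" by (simp add: perp_def)
  qed
qed

lemma perp_inverse_image:
  fixes S :: "pdo^'n^'n"
  assumes S: "S \<in> monic_order_0"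
  shows "perp (pdo_mat_act (matrix_inv S) ` polynomial_part) =
    pdo_mat_act (pdo_mat_adjoint S) ` polynomial_part"
proof -
  let ?A = "pdo_mat_act (pdo_mat_adjoint S)" and ?B = "pdo_mat_act (matrix_inv (pdo_mat_adjoint S))"
  have AB: "?A (?B f) = f" and BA: "?B (?A f) = f" for f
    using S by (simp_all add: monic_order_0_inverse monic_order_0_adjoint flip: pdo_mat_act_mult)
  \<comment> \<open>Write \<open>f\<close> as the adjoint of \<open>S\<close> applied to
    \<open>?B f\<close> and move the adjoint across the pairing, where it cancels the inverse of
    \<open>S\<close>.\<close>
  have "residue_pairing f (pdo_mat_act (matrix_inv S) w) = residue_pairing (?B f) w" for f w
  proof -
    have "residue_pairing f (pdo_mat_act (matrix_inv S) w) =
        residue_pairing (pdo_mat_act S (pdo_mat_act (matrix_inv S) w)) (?B f)"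
      by (metis AB residue_pairing_adjoint residue_pairing_commute)
    also have "pdo_mat_act S (pdo_mat_act (matrix_inv S) w) = w"
      using S by (simp add: monic_order_0_inverse flip: pdo_mat_act_mult)
    finally show ?thesis by (simp only: residue_pairing_commute)
  qed
  then have "f \<in> perp (pdo_mat_act (matrix_inv S) ` polynomial_part) \<longleftrightarrow> ?B f \<in> perp polynomial_part" for f
    by (auto simp: perp_def)
  moreover have "f \<in> ?A ` polynomial_part \<longleftrightarrow> ?B f \<in> polynomial_part" for f
  proof
    assume "?B f \<in> polynomial_part"
    then show "f \<in> ?A ` polynomial_part"
      by (intro image_eqI[of _ _ "?B f"]) (simp_all add: AB)
  qed (auto simp: BA)
  ultimately show ?thesis
    unfolding perp_polynomial_part by blast
qed

theorem theorem6p6: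
  fixes W :: "(complex fls^'n) set" and S :: "pdo^'n^'n"
  assumes "W \<in> Grassmannian"
    and "W \<in> big_cell"
    and "S \<in> monic_order_0"
    and "corresponds S W"
  shows "invertible (pdo_mat_adjoint S) \<and> matrix_inv (pdo_mat_adjoint S) \<in> monic_order_0 \<and>
    corresponds (matrix_inv (pdo_mat_adjoint S)) (perp W)"
proof -
  note adj = monic_order_0_adjoint[OF assms(3)]
  have "perp W = pdo_mat_act (pdo_mat_adjoint S) ` polynomial_part"
    using assms(3,4) by (simp add: corresponds_def perp_inverse_image)
  \<comment> \<open>\<open>corresponds\<close> applies the inverse of its operator, here the inverse
    of an inverse, which is the adjoint of \<open>S\<close> again.\<close>
  then show ?thesis
    using monic_order_0_inverse[OF adj] monic_image_in_big_cell[OF adj]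
    by (simp add: corresponds_def matrix_inv_matrix_inv[OF adj])
qed

end
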